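(* For every $n$ there is a simple arrangement $\mathcal{L}$ of $n$ lines in the plane such that every subset of $\mathcal{L}$ of size $n^{5/6+o(1)}$ (with $o(1)\to 0$ as $n\to\infty$) contains all the lines bounding some cell of the arrangement. In particular, the chromatic number of the hypergraph $\mathcal{H}_{\text{line-cell}}$ of this arrangement is at least $n^{1/6-o(1)}$.
   Context: A simple arrangement of a finite set $\mathcal{L}$ of lines in $\mathbb{R}^2$ is one with no two parallel lines and no three lines through a common point. Its cells are the connected components of $\mathbb{R}^2\setminus\bigcup_{\ell\in\mathcal{L}}\ell$. The hypergraph $\mathcal{H}_{\text{line-cell}}$ has vertex set $\mathcal{L}$ and, for each cell, a hyperedge consisting of the lines that contain a boundary edge of that cell. The chromatic number of a hypergraph is the minimum number of colors in a vertex coloring with no monochromatic hyperedge. *)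

theory Defs
  imports "HOL-Analysis.Analysis"
begin

definition is_line :: "(real^2) set \<Rightarrow> bool" where
  "is_line L \<longleftrightarrow> (\<exists>a b. a \<noteq> b \<and> L = {a + t *\<^sub>R (b - a) | t. True})"

definition simple_arrangement :: "(real^2) set set \<Rightarrow> bool" where
  "simple_arrangement \<L> \<longleftrightarrow>
     finite \<L> \<and> (\<forall>L\<in>\<L>. is_line L) \<and>
     (\<forall>L1\<in>\<L>. \<forall>L2\<in>\<L>. L1 \<noteq> L2 \<longrightarrow> L1 \<inter> L2 \<noteq> {}) \<and>
     (\<forall>L1\<in>\<L>. \<forall>L2\<in>\<L>. \<forall>L3\<in>\<L>. L1 \<noteq> L2 \<and> L1 \<noteq> L3 \<and> L2 \<noteq> L3 \<longrightarrow> L1 \<inter> L2 \<inter> L3 = {})"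

definition cells :: "(real^2) set set \<Rightarrow> (real^2) set set" where
  "cells \<L> = components (UNIV - \<Union>\<L>)"

definition cell_lines :: "(real^2) set set \<Rightarrow> (real^2) set \<Rightarrow> (real^2) set set" where
  "cell_lines \<L> C = {L \<in> \<L>. \<exists>a b. a \<noteq> b \<and> closed_segment a b \<subseteq> L \<inter> frontier C}"

definition line_cell_edges :: "(real^2) set set \<Rightarrow> (real^2) set set set" where
  "line_cell_edges \<L> = cell_lines \<L> ` cells \<L>"

definition proper_coloring ::
  "'v set \<Rightarrow> 'v set set \<Rightarrow> nat \<Rightarrow> ('v \<Rightarrow> nat) \<Rightarrow> bool" where
  "proper_coloring V E k f \<longleftrightarrow>
     (\<forall>v\<in>V. f v < k) \<and> (\<forall>e\<in>E. \<not> (\<exists>c. \<forall>v\<in>e. f v = c))"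

end

theory Submission
  imports Defs "HOL-Real_Asymp.Real_Asymp"
begin

text \<open>
  Points \<open>(a, b)\<close> are dual to lines \<open>y = a x + b\<close>, and three points are collinear iff their lines are
  concurrent. If no four points are collinear, replacing \<open>b\<close> by \<open>b + \<epsilon> a\<^sup>2\<close> for a tiny \<open>\<epsilon>\<close> makes the
  arrangement simple and opens every triple point into a triangular cell. So it suffices to find, up
  to lower order factors, \<open>n\<close> points without four on a line such that every set of \<open>n\<^bsup>5/6\<^esup>\<close> of them
  contains three on a line (Balogh and Solymosi).

  These points form a random subset of a generic planar projection of the grid \<open>[N]\<^sup>3\<close>, \<open>N = q\<^sup>3\<close>, with
  density about \<open>1 / N\<close>: the grid has only about \<open>N\<^sup>6\<close> collinear quadruples, so one point of each
  surviving quadruple can be deleted. By the union bound it remains to cover all grid subsets without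
  collinear triples by \<open>exp (q\<^bsup>5+o(1)\<^esup>)\<close> containers of size about \<open>q\<^sup>8\<close>. A set \<open>A\<close> larger than that carries
  a linear, almost regular system of collinear triples of degree \<open>d\<close>, about \<open>(card A / N\<^sup>2)\<^sup>3\<close>. Its
  independent sets are enumerated by branching on whether a vertex \<open>v\<close> of large degree belongs to them;
  if so, the pairs completing \<open>v\<close> to a triple become edges of an auxiliary graph, and vertices reaching
  degree \<open>\<surd>d\<close> in that graph are branched on first. This yields few containers, each smaller than \<open>A\<close> by
  a constant factor, and the step is iterated.
\<close>

section \<open>Containers for linear triple systems\<close>

text \<open>The exponent 5/6 comes from a balance. For a set \<open>A\<close> of about N^2 R points,
  directions from [R]^3 are usable, since each of them has only O(R N^2) lines; this gives degree d
  of order R^3. Branching then costs an exponent of about card A / sqrt d = N^2 / sqrt R, while a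
  container of N^2 R points, thinned at rate 1/N, keeps about N R points. The two agree for R =
  N^(2/3), with common value N^(5/3) = (N^2)^(5/6), and about N^2 points survive. Taking N = q^3
  makes all these quantities integral powers of q. The auxiliary graph is there because putting a
  vertex into an independent set only forbids pairs. This progress is stored as edges until some
  vertex has about sqrt d of them, and then taking that vertex removes sqrt d others at once.
  Linearity ensures that stored pairs are new and that degrees grow by one at a time.\<close>

definition independent_in :: "'a set set \<Rightarrow> 'a set \<Rightarrow> bool" where
  "independent_in F I \<longleftrightarrow> (\<forall>e\<in>F. \<not> e \<subseteq> I)"

text \<open>Containers lie inside \<open>X\<close> so that a further shrinking step can be applied
  within each of them.\<close>

definition has_containers :: "'a set set \<Rightarrow> 'a set \<Rightarrow> real \<Rightarrow> real \<Rightarrow> bool" where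
  "has_containers F X K M \<longleftrightarrow>
     (\<exists>\<C>. finite \<C> \<and> real (card \<C>) \<le> K \<and> (\<forall>C\<in>\<C>. C \<subseteq> X \<and> real (card C) \<le> M) \<and>
        (\<forall>I\<subseteq>X. independent_in F I \<longrightarrow> (\<exists>C\<in>\<C>. I \<subseteq> C)))"

lemma has_containersI:
  assumes "finite \<C>" "real (card \<C>) \<le> K" "\<And>C. C \<in> \<C> \<Longrightarrow> C \<subseteq> X \<and> real (card C) \<le> M"
    and "\<And>I. I \<subseteq> X \<Longrightarrow> independent_in F I \<Longrightarrow> \<exists>C\<in>\<C>. I \<subseteq> C"
  shows "has_containers F X K M"
  using assms unfolding has_containers_def by blast

lemma has_containers_mono:
  assumes "has_containers F X K M" "K \<le> K'" "M \<le> M'" "F \<subseteq> F'"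
  shows "has_containers F' X K' M'"
proof -
  obtain \<C> where \<C>: "finite \<C>" "real (card \<C>) \<le> K" "\<forall>C\<in>\<C>. C \<subseteq> X \<and> real (card C) \<le> M"
    "\<forall>I\<subseteq>X. independent_in F I \<longrightarrow> (\<exists>C\<in>\<C>. I \<subseteq> C)"
    using assms(1) unfolding has_containers_def by blast
  show ?thesis
  proof (rule has_containersI[of \<C>])
    fix I assume I: "I \<subseteq> X" "independent_in F' I"
    have "independent_in F I" using I(2) assms(4) unfolding independent_in_def by (meson subsetD)
    then show "\<exists>C\<in>\<C>. I \<subseteq> C" using \<C>(4) I(1) by metis
  next
    fix C assume "C \<in> \<C>"
    then show "C \<subseteq> X \<and> real (card C) \<le> M'" using \<C>(3) assms(3) by (meson order_trans)
  qed (use \<C>(1,2) assms(2) in linarith)+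
qed

lemma has_containers_self:
  assumes "real (card X) \<le> M" "1 \<le> K"
  shows "has_containers F X K M"
  by (rule has_containersI[of "{X}"]) (use assms in auto)

text \<open>For sets through \<open>v\<close>, the point is put back into the containers of the
  residual problem, hence the bound \<open>M - 1\<close> there. Separate families \<open>F1\<close>
  and \<open>F2\<close> let the two branches carry different auxiliary graphs.\<close>

lemma has_containers_branch:
  assumes v: "v \<in> X"
    and excl: "has_containers F1 (X - {v}) K1 M"
    and incl: "has_containers F2 Y K2 (M - 1)" and Y: "Y \<subseteq> X"
    and F1: "F1 \<subseteq> F"
    and F2: "\<And>I. I \<subseteq> X \<Longrightarrow> v \<in> I \<Longrightarrow> independent_in F I \<Longrightarrow> I - {v} \<subseteq> Y \<and> independent_in F2 (I - {v})"
  shows "has_containers F X (K1 + K2) M"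
proof -
  obtain \<C>1 where \<C>1: "finite \<C>1" "real (card \<C>1) \<le> K1"
    "\<forall>C\<in>\<C>1. C \<subseteq> X - {v} \<and> real (card C) \<le> M"
    "\<forall>I\<subseteq>X - {v}. independent_in F1 I \<longrightarrow> (\<exists>C\<in>\<C>1. I \<subseteq> C)"
    using excl unfolding has_containers_def by blast
  obtain \<C>2 where \<C>2: "finite \<C>2" "real (card \<C>2) \<le> K2"
    "\<forall>C\<in>\<C>2. C \<subseteq> Y \<and> real (card C) \<le> M - 1"
    "\<forall>I\<subseteq>Y. independent_in F2 I \<longrightarrow> (\<exists>C\<in>\<C>2. I \<subseteq> C)"
    using incl unfolding has_containers_def by blast
  show ?thesis
  proof (rule has_containersI[of "\<C>1 \<union> insert v ` \<C>2"])
    show "finite (\<C>1 \<union> insert v ` \<C>2)" using \<C>1 \<C>2 by auto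
    have "card (\<C>1 \<union> insert v ` \<C>2) \<le> card \<C>1 + card (insert v ` \<C>2)" by (rule card_Un_le)
    also have "\<dots> \<le> card \<C>1 + card \<C>2" using \<C>2(1) by (simp add: card_image_le)
    finally show "real (card (\<C>1 \<union> insert v ` \<C>2)) \<le> K1 + K2" using \<C>1(2) \<C>2(2) by linarith
    fix C assume "C \<in> \<C>1 \<union> insert v ` \<C>2"
    then show "C \<subseteq> X \<and> real (card C) \<le> M"
    proof
      assume "C \<in> \<C>1" then show ?thesis using \<C>1(3) by auto
    next
      assume "C \<in> insert v ` \<C>2"
      then obtain D where D: "D \<in> \<C>2" "C = insert v D" by auto
      have "card C \<le> Suc (card D)" unfolding D(2) by (rule card_insert_le_m1) auto
      then have "real (card C) \<le> M" using \<C>2(3) D(1) by fastforce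
      then show ?thesis using D \<C>2(3) Y v by blast
    qed
  next
    fix I assume I: "I \<subseteq> X" "independent_in F I"
    show "\<exists>C\<in>\<C>1 \<union> insert v ` \<C>2. I \<subseteq> C"
    proof (cases "v \<in> I")
      case True
      then obtain C where "C \<in> \<C>2" "I - {v} \<subseteq> C" using F2[OF I(1) True I(2)] \<C>2(4) by blast
      then show ?thesis by blast
    next
      case False
      have "independent_in F1 I" using I F1 unfolding independent_in_def by blast
      moreover have "I \<subseteq> X - {v}" using False I by blast
      ultimately obtain C where "C \<in> \<C>1" "I \<subseteq> C" using \<C>1(4) by metis
      then show ?thesis by blast
    qed
  qed
qed

lemma has_containers_compose:
  assumes X: "has_containers F X K1 M1" and K2: "K2 \<ge> 0"
    and Y: "\<And>Y. Y \<subseteq> X \<Longrightarrow> real (card Y) \<le> M1 \<Longrightarrow> has_containers F Y K2 M2"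
  shows "has_containers F X (K1 * K2) M2"
proof -
  obtain \<C> where \<C>: "finite \<C>" "real (card \<C>) \<le> K1" "\<forall>C\<in>\<C>. C \<subseteq> X \<and> real (card C) \<le> M1"
    "\<forall>I\<subseteq>X. independent_in F I \<longrightarrow> (\<exists>C\<in>\<C>. I \<subseteq> C)"
    using X unfolding has_containers_def by blast
  have "\<forall>C\<in>\<C>. \<exists>\<D>. finite \<D> \<and> real (card \<D>) \<le> K2 \<and> (\<forall>D\<in>\<D>. D \<subseteq> C \<and> real (card D) \<le> M2) \<and>
        (\<forall>I\<subseteq>C. independent_in F I \<longrightarrow> (\<exists>D\<in>\<D>. I \<subseteq> D))"
    using Y \<C>(3) unfolding has_containers_def by blast
  then obtain \<D> where \<D>: "\<forall>C\<in>\<C>. finite (\<D> C) \<and> real (card (\<D> C)) \<le> K2 \<and>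
        (\<forall>D\<in>\<D> C. D \<subseteq> C \<and> real (card D) \<le> M2) \<and>
        (\<forall>I\<subseteq>C. independent_in F I \<longrightarrow> (\<exists>D\<in>\<D> C. I \<subseteq> D))"
    by metis
  show ?thesis
  proof (rule has_containersI[of "\<Union>C\<in>\<C>. \<D> C"])
    show "finite (\<Union>C\<in>\<C>. \<D> C)" using \<C> \<D> by blast
    have "real (card (\<Union>C\<in>\<C>. \<D> C)) \<le> real (\<Sum>C\<in>\<C>. card (\<D> C))"
      using card_UN_le[OF \<C>(1)] by (simp only: of_nat_le_iff)
    also have "\<dots> = (\<Sum>C\<in>\<C>. real (card (\<D> C)))" by simp
    also have "\<dots> \<le> (\<Sum>C\<in>\<C>. K2)" using \<D> by (intro sum_mono) blast
    also have "\<dots> = real (card \<C>) * K2" by simp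
    also have "\<dots> \<le> K1 * K2" using \<C>(2) K2 by (rule mult_right_mono)
    finally show "real (card (\<Union>C\<in>\<C>. \<D> C)) \<le> K1 * K2" .
    fix D assume "D \<in> (\<Union>C\<in>\<C>. \<D> C)"
    then obtain C where C: "C \<in> \<C>" "D \<in> \<D> C" by blast
    then have "D \<subseteq> C \<and> real (card D) \<le> M2" using \<D> by metis
    moreover have "C \<subseteq> X" using C \<C>(3) by metis
    ultimately show "D \<subseteq> X \<and> real (card D) \<le> M2" by auto
  next
    fix I assume I: "I \<subseteq> X" "independent_in F I"
    then obtain C where C: "C \<in> \<C>" "I \<subseteq> C" using \<C>(4) by metis
    then obtain D where "D \<in> \<D> C" "I \<subseteq> D" using \<D> I(2) by metis
    then show "\<exists>D\<in>\<Union>C\<in>\<C>. \<D> C. I \<subseteq> D" using C(1) by blast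
  qed
qed

text \<open>Stated for arbitrary families because it is applied to triples, to edges of the
  auxiliary graph and, with \<open>t = 1\<close>, to the link of a vertex.\<close>

lemma card_delete_vertices:
  assumes fin: "finite W" "finite G" and deg: "\<And>v. v \<in> W \<Longrightarrow> card {g \<in> G. v \<in> g} \<le> t"
  shows "card G \<le> card {g \<in> G. g \<inter> W = {}} + t * card W"
proof -
  have "G \<subseteq> {g \<in> G. g \<inter> W = {}} \<union> (\<Union>v\<in>W. {g \<in> G. v \<in> g})" by blast
  then have "card G \<le> card ({g \<in> G. g \<inter> W = {}} \<union> (\<Union>v\<in>W. {g \<in> G. v \<in> g}))"
    using fin by (intro card_mono) auto
  also have "\<dots> \<le> card {g \<in> G. g \<inter> W = {}} + card (\<Union>v\<in>W. {g \<in> G. v \<in> g})" by (rule card_Un_le)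
  also have "card (\<Union>v\<in>W. {g \<in> G. v \<in> g}) \<le> (\<Sum>v\<in>W. card {g \<in> G. v \<in> g})"
    by (rule card_UN_le[OF fin(1)])
  also have "\<dots> \<le> (\<Sum>v\<in>W. t)" using deg by (rule sum_mono)
  finally show ?thesis by (simp add: mult.commute)
qed

section \<open>Branching in a linear triple system\<close>

locale linear_triple_system =
  fixes A :: "'a set" and H :: "'a set set"
  assumes finite_points: "finite A"
    and triple_subset: "e \<in> H \<Longrightarrow> e \<subseteq> A"
    and triple_card: "e \<in> H \<Longrightarrow> card e = 3"
    and linear: "\<lbrakk>e \<in> H; e' \<in> H; x \<in> e; x \<in> e'; y \<in> e; y \<in> e'; x \<noteq> y\<rbrakk> \<Longrightarrow> e = e'"
begin

lemma finite_triples: "finite H"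
  by (rule finite_subset[of _ "Pow A"]) (use finite_points triple_subset in auto)

text \<open>Fewer than \<open>card A / 12\<close> vertices are missing and each destroys at most
  \<open>d\<close> triples, so at least \<open>d * card A / 12\<close> triples lie inside
  \<open>X\<close>; their average degree is at least \<open>d / 4\<close>.\<close>

lemma high_degree_vertex:
  assumes X: "X \<subseteq> A" and deg: "\<And>v. v \<in> A \<Longrightarrow> card {e \<in> H. v \<in> e} \<le> d"
    and edges: "real d * real (card A) / 6 \<le> real (card H)"
    and large: "11 / 12 * real (card A) < real (card X)"
  obtains v where "v \<in> X" "real d / 4 \<le> real (card {e \<in> H. v \<in> e \<and> e \<subseteq> X})"
proof -
  have finX: "finite X" using X finite_points finite_subset by blast
  define HX where "HX = {e \<in> H. e \<inter> (A - X) = {}}"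
  have HX_sub: "HX = {e \<in> H. e \<subseteq> X}" unfolding HX_def using triple_subset by blast
  have "card H \<le> card HX + d * card (A - X)" unfolding HX_def
    by (rule card_delete_vertices) (use finite_points finite_triples deg in auto)
  then have "real (card H) \<le> real (card HX) + real d * real (card (A - X))"
    by (metis of_nat_le_iff of_nat_add of_nat_mult)
  moreover have "real (card (A - X)) = real (card A) - real (card X)"
    using X finX by (simp add: card_Diff_subset card_mono finite_points of_nat_diff)
  moreover have "real d * real (card (A - X)) \<le> real d * (real (card A) / 12)"
    using large calculation(2) by (intro mult_left_mono) auto
  ultimately have HX_large: "real d * real (card A) / 12 \<le> real (card HX)"
    using edges by linarith
  have "\<exists>v\<in>X. real d / 4 \<le> real (card {e \<in> HX. v \<in> e})"
  proof (rule ccontr)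
    assume "\<not> ?thesis"
    then have small: "\<forall>v\<in>X. real (card {e \<in> HX. v \<in> e}) < real d / 4" by force
    have "X \<noteq> {}" using large by (cases "X = {}") auto
    have "(\<Sum>v\<in>X. card {e \<in> HX. v \<in> e}) = 3 * card HX"
    proof (rule sum_multicount)
      show "\<forall>e\<in>HX. card {v \<in> X. v \<in> e} = 3"
      proof
        fix e assume "e \<in> HX"
        then have "{v \<in> X. v \<in> e} = e" "card e = 3" using HX_sub triple_card by auto
        then show "card {v \<in> X. v \<in> e} = 3" by simp
      qed
    qed (use finX finite_triples HX_sub in auto)
    then have "3 * real (card HX) = (\<Sum>v\<in>X. real (card {e \<in> HX. v \<in> e}))"
      by (metis of_nat_sum of_nat_mult of_nat_numeral)
    also have "\<dots> < (\<Sum>v\<in>X. real d / 4)"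
      using small finX \<open>X \<noteq> {}\<close> by (intro sum_strict_mono) auto
    also have "\<dots> = real d / 4 * real (card X)" by simp
    also have "\<dots> \<le> real d / 4 * real (card A)"
      using X finite_points by (intro mult_left_mono) (auto intro: card_mono)
    finally show False using HX_large by simp
  qed
  then obtain v where v: "v \<in> X" "real d / 4 \<le> real (card {e \<in> HX. v \<in> e})" by blast
  moreover have "{e \<in> HX. v \<in> e} = {e \<in> H. v \<in> e \<and> e \<subseteq> X}" unfolding HX_sub by blast
  ultimately show ?thesis using that by simp
qed

text \<open>The potential \<open>2 * t * card X - card G\<close> drops by at least \<open>t\<close>
  when a vertex is excluded and by at least \<open>t\<^sup>2 / 4\<close> when one is included. The
  condition on \<open>\<rho>\<close> is the resulting recurrence for the number of leaves. A
  container is a leaf set of size at most \<open>11 / 12 * card A\<close> plus the included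
  vertices, each paid for by its drop. By the last clause on \<open>G\<close>, its pairs come from
  triples whose third point has already left \<open>X\<close>.\<close>

lemma containers_branching:
  fixes t d :: nat and \<rho> :: real
  assumes deg: "\<And>v. v \<in> A \<Longrightarrow> card {e \<in> H. v \<in> e} \<le> d"
    and edges: "real d * real (card A) / 6 \<le> real (card H)"
    and t: "0 < t" "t\<^sup>2 \<le> d"
    and \<rho>: "0 < \<rho>" "exp (- \<rho>) + exp (- \<rho> * (real t / 4)) \<le> 1"
    and X: "X \<subseteq> A"
    and G: "\<And>g. g \<in> G \<Longrightarrow> g \<subseteq> X \<and> card g = 2 \<and> (\<exists>w\<in>A - X. insert w g \<in> H)"
    and degG: "\<And>v. v \<in> X \<Longrightarrow> card {g \<in> G. v \<in> g} \<le> t"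
  shows "has_containers (H \<union> G) X
           (exp (\<rho> * ((2 * real t * real (card X) - real (card G)) / real t)))
           (11 / 12 * real (card A) + 4 * (2 * real t * real (card X) - real (card G)) / (real t)\<^sup>2)"
  using X G degG
proof (induction "card X" arbitrary: X G rule: less_induct)
  case less
  note X = less.prems(1) and G = less.prems(2) and degG = less.prems(3)
  define \<mu> where "\<mu> Y G = 2 * real t * real (card Y) - real (card G)" for Y :: "'a set" and G :: "'a set set"
  have IH: "has_containers (H \<union> G') Y (exp (\<rho> * (\<mu> Y G' / real t)))
       (11 / 12 * real (card A) + 4 * \<mu> Y G' / (real t)\<^sup>2)"
    if "card Y < card X" "Y \<subseteq> A" "\<And>g. g \<in> G' \<Longrightarrow> g \<subseteq> Y \<and> card g = 2 \<and> (\<exists>w\<in>A - Y. insert w g \<in> H)"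
      "\<And>v. v \<in> Y \<Longrightarrow> card {g \<in> G'. v \<in> g} \<le> t" for Y G'
    unfolding \<mu>_def by (rule less.hyps) (use that in auto)
  have finX: "finite X" using X finite_points finite_subset by blast
  have finG: "finite G" by (rule finite_subset[of _ "Pow X"]) (use G finX in auto)
  have t0: "0 < real t" using t by simp
  \<comment> \<open>Deleting a vertex costs the potential at most the degree bound but gains twice that.\<close>
  have delete: "\<mu> (X - W) {g \<in> G. g \<inter> W = {}} \<le> \<mu> X G - real t * real (card W)" if "W \<subseteq> X" for W
  proof -
    have finW: "finite W" using that finX finite_subset by blast
    have "card G \<le> card {g \<in> G. g \<inter> W = {}} + t * card W"
      by (rule card_delete_vertices) (use finW finG degG that in auto)
    then have "real (card G) \<le> real (card {g \<in> G. g \<inter> W = {}}) + real t * real (card W)"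
      by (metis of_nat_le_iff of_nat_add of_nat_mult)
    moreover have cX: "real (card (X - W)) = real (card X) - real (card W)"
      using that finX finW by (simp add: card_Diff_subset card_mono of_nat_diff)
    ultimately show ?thesis unfolding \<mu>_def cX by (simp add: algebra_simps)
  qed
  have \<mu>_nonneg: "0 \<le> \<mu> X G"
  proof -
    have "\<not> g \<inter> X = {}" if "g \<in> G" for g
      using G[OF that] by (metis card.empty inf.absorb1 zero_neq_numeral)
    then have none: "{g \<in> G. g \<inter> X = {}} = {}" by blast
    have "card G \<le> t * card X"
      using card_delete_vertices[OF finX finG degG] unfolding none by simp
    then have "real (card G) \<le> real t * real (card X)" by (metis of_nat_le_iff of_nat_mult)
    moreover have "0 \<le> real t * real (card X)" by simp
    ultimately show ?thesis unfolding \<mu>_def by linarith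
  qed
  have delete_G: "g \<subseteq> X - W \<and> card g = 2 \<and> (\<exists>w\<in>A - (X - W). insert w g \<in> H)"
    if "g \<in> {g \<in> G. g \<inter> W = {}}" for g W using that G[of g] by blast
  have delete_deg: "card {g \<in> {g \<in> G. g \<inter> W = {}}. v \<in> g} \<le> card {g \<in> G. v \<in> g}" for v W
    using finG by (intro card_mono) auto
  \<comment> \<open>The part common to both cases below: each only chooses \<open>v\<close> and
    describes the residual problem \<open>Y\<close>, \<open>G'\<close> after including
    \<open>v\<close>. The exclusion branch is always the same.\<close>
  have main: "has_containers (H \<union> G) X (exp (\<rho> * (\<mu> X G / real t)))
       (11 / 12 * real (card A) + 4 * \<mu> X G / (real t)\<^sup>2)"
    if v: "v \<in> X" and Y: "Y \<subseteq> X - {v}"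
      and G': "\<And>g. g \<in> G' \<Longrightarrow> g \<subseteq> Y \<and> card g = 2 \<and> (\<exists>w\<in>A - Y. insert w g \<in> H)"
      and degG': "\<And>v. v \<in> Y \<Longrightarrow> card {g \<in> G'. v \<in> g} \<le> t"
      and drop: "\<mu> Y G' \<le> \<mu> X G - (real t)\<^sup>2 / 4"
      and indep: "\<And>I. I \<subseteq> X \<Longrightarrow> v \<in> I \<Longrightarrow> independent_in (H \<union> G) I \<Longrightarrow>
              I - {v} \<subseteq> Y \<and> independent_in (H \<union> G') (I - {v})"
    for v Y G'
  proof -
    define G1 where "G1 = {g \<in> G. g \<inter> {v} = {}}"
    have card1: "card (X - {v}) < card X" using v finX by (meson card_Diff1_less)
    have card2: "card Y < card X" using card1 card_mono[OF _ Y] finX by auto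
    have \<mu>1: "\<mu> (X - {v}) G1 \<le> \<mu> X G - real t" using delete[of "{v}"] v unfolding G1_def by simp
    have 1: "has_containers (H \<union> G1) (X - {v}) (exp (\<rho> * (\<mu> (X - {v}) G1 / real t)))
       (11 / 12 * real (card A) + 4 * \<mu> (X - {v}) G1 / (real t)\<^sup>2)"
    proof (rule IH[OF card1])
      show "X - {v} \<subseteq> A" using X by auto
      show "\<And>g. g \<in> G1 \<Longrightarrow> g \<subseteq> X - {v} \<and> card g = 2 \<and> (\<exists>w\<in>A - (X - {v}). insert w g \<in> H)"
        unfolding G1_def by (rule delete_G)
      show "card {g \<in> G1. w \<in> g} \<le> t" if "w \<in> X - {v}" for w
        using that degG[of w] delete_deg[of "{v}" w] unfolding G1_def by auto
    qed
    have 2: "has_containers (H \<union> G') Y (exp (\<rho> * (\<mu> Y G' / real t)))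
       (11 / 12 * real (card A) + 4 * \<mu> Y G' / (real t)\<^sup>2)"
      by (rule IH[OF card2]) (use X Y G' degG' in auto)
    let ?M = "11 / 12 * real (card A) + 4 * \<mu> X G / (real t)\<^sup>2"
    let ?u = "\<mu> X G / real t"
    have excl: "has_containers (H \<union> G1) (X - {v}) (exp (\<rho> * (?u - 1))) ?M"
    proof (rule has_containers_mono[OF 1])
      have "\<mu> (X - {v}) G1 / real t \<le> (\<mu> X G - real t) / real t"
        using \<mu>1 t0 by (intro divide_right_mono) auto
      also have "\<dots> = ?u - 1" using t0 by (simp add: field_simps)
      finally have "\<rho> * (\<mu> (X - {v}) G1 / real t) \<le> \<rho> * (?u - 1)"
        using \<rho>(1) by (intro mult_left_mono) auto
      then show "exp (\<rho> * (\<mu> (X - {v}) G1 / real t)) \<le> exp (\<rho> * (?u - 1))" by simp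
      show "11 / 12 * real (card A) + 4 * \<mu> (X - {v}) G1 / (real t)\<^sup>2 \<le> ?M"
        using \<mu>1 t0 by (intro add_left_mono divide_right_mono) auto
    qed auto
    have incl: "has_containers (H \<union> G') Y (exp (\<rho> * (?u - real t / 4))) (?M - 1)"
    proof (rule has_containers_mono[OF 2])
      have "\<mu> Y G' / real t \<le> (\<mu> X G - (real t)\<^sup>2 / 4) / real t"
        using drop t0 by (intro divide_right_mono) auto
      also have "\<dots> = ?u - real t / 4" using t0 by (simp add: field_simps power2_eq_square)
      finally have "\<rho> * (\<mu> Y G' / real t) \<le> \<rho> * (?u - real t / 4)"
        using \<rho>(1) by (intro mult_left_mono) auto
      then show "exp (\<rho> * (\<mu> Y G' / real t)) \<le> exp (\<rho> * (?u - real t / 4))" by simp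
      have "4 * \<mu> Y G' / (real t)\<^sup>2 \<le> 4 * (\<mu> X G - (real t)\<^sup>2 / 4) / (real t)\<^sup>2"
        using drop t0 by (intro divide_right_mono) auto
      also have "\<dots> = 4 * \<mu> X G / (real t)\<^sup>2 - 1" using t0 by (simp add: field_simps)
      finally show "11 / 12 * real (card A) + 4 * \<mu> Y G' / (real t)\<^sup>2 \<le> ?M - 1" by simp
    qed auto
    have both: "has_containers (H \<union> G) X (exp (\<rho> * (?u - 1)) + exp (\<rho> * (?u - real t / 4))) ?M"
      by (rule has_containers_branch[OF v excl incl]) (use Y indep G1_def in auto)
    have "exp (\<rho> * (?u - 1)) + exp (\<rho> * (?u - real t / 4)) =
        exp (\<rho> * ?u) * (exp (- \<rho>) + exp (- \<rho> * (real t / 4)))"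
      by (simp add: algebra_simps flip: exp_add)
    also have "\<dots> \<le> exp (\<rho> * ?u) * 1" using \<rho>(2) by (intro mult_left_mono) auto
    finally have "exp (\<rho> * (?u - 1)) + exp (\<rho> * (?u - real t / 4)) \<le> exp (\<rho> * ?u)" by simp
    then show ?thesis by (rule has_containers_mono[OF both]) auto
  qed
  define N where "N = (\<lambda>v. {u. u \<noteq> v \<and> {u, v} \<in> G})"
  have N_sub: "N v \<subseteq> X - {v}" for v unfolding N_def using G by auto
  have card_N: "card (N v) = card {g \<in> G. v \<in> g}" for v
  proof (rule bij_betw_same_card[of "\<lambda>u. {u, v}"])
    show "bij_betw (\<lambda>u. {u, v}) (N v) {g \<in> G. v \<in> g}"
    proof (rule bij_betwI')
      show "({u, v} = {u', v}) = (u = u')" if "u \<in> N v" "u' \<in> N v" for u u'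
        using that unfolding N_def by (auto simp: doubleton_eq_iff)
      show "{u, v} \<in> {g \<in> G. v \<in> g}" if "u \<in> N v" for u using that unfolding N_def by auto
      show "\<exists>u\<in>N v. g = {u, v}" if "g \<in> {g \<in> G. v \<in> g}" for g
      proof -
        have "card g = 2" "v \<in> g" "g \<in> G" using that G by auto
        then obtain x y where "g = {x, y}" "x \<noteq> y" by (meson card_2_iff)
        then show ?thesis using \<open>v \<in> g\<close> \<open>g \<in> G\<close> unfolding N_def by (auto simp: insert_commute)
      qed
    qed
  qed
  have card_W: "card (insert v (N v)) = Suc (card (N v))" for v
    using N_sub[of v] finX by (subst card_insert_disjoint) (auto intro: finite_subset)
  show ?case
  proof (cases "real (card X) \<le> 11 / 12 * real (card A)")
    case True
    have "0 \<le> 4 * \<mu> X G / (real t)\<^sup>2" using \<mu>_nonneg by simp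
    then have "real (card X) \<le> 11 / 12 * real (card A) + 4 * \<mu> X G / (real t)\<^sup>2" using True by linarith
    moreover have "1 \<le> exp (\<rho> * (\<mu> X G / real t))" using \<mu>_nonneg \<rho>(1) by simp
    ultimately show ?thesis unfolding \<mu>_def by (rule has_containers_self)
  next
    case large: False
    show ?thesis
    proof (cases "\<exists>v\<in>X. t \<le> card {g \<in> G. v \<in> g}")
      case True
      then obtain v where v: "v \<in> X" "t \<le> card {g \<in> G. v \<in> g}" by blast
      \<comment> \<open>An independent set through \<open>v\<close> misses its neighbours in
        \<open>G\<close>, at least \<open>t\<close> in number, and each deleted vertex lowers the
        potential by \<open>t\<close>.\<close>
      define W where "W = insert v (N v)"
      have W: "W \<subseteq> X" unfolding W_def using v N_sub[of v] by auto
      have "t \<le> card W" unfolding W_def card_W using v card_N by simp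
      then have "real t * real t \<le> real t * real (card W)" by (intro mult_left_mono) auto
      then have "(real t)\<^sup>2 / 4 \<le> real t * real (card W)"
        using zero_le_square[of "real t"] unfolding power2_eq_square by linarith
      then have drop: "\<mu> (X - W) {g \<in> G. g \<inter> W = {}} \<le> \<mu> X G - (real t)\<^sup>2 / 4"
        using delete[OF W] by linarith
      have "has_containers (H \<union> G) X (exp (\<rho> * (\<mu> X G / real t)))
       (11 / 12 * real (card A) + 4 * \<mu> X G / (real t)\<^sup>2)"
      proof (rule main[OF v(1) _ delete_G _ drop])
        show "X - W \<subseteq> X - {v}" unfolding W_def by auto
        show "card {g \<in> {g \<in> G. g \<inter> W = {}}. w \<in> g} \<le> t" if "w \<in> X - W" for w
          using that degG[of w] delete_deg[of W w] by auto
        fix I assume I: "I \<subseteq> X" "v \<in> I" "independent_in (H \<union> G) I"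
        have "u \<notin> I" if "u \<in> N v" for u
          using that I unfolding N_def independent_in_def by (metis UnI2 empty_subsetI insert_subset mem_Collect_eq)
        moreover have "independent_in (H \<union> {g \<in> G. g \<inter> W = {}}) (I - {v})"
          using I(3) unfolding independent_in_def by blast
        ultimately show "I - {v} \<subseteq> X - W \<and> independent_in (H \<union> {g \<in> G. g \<inter> W = {}}) (I - {v})"
          using I(1) unfolding W_def by blast
      qed auto
      then show ?thesis unfolding \<mu>_def .
    next
      case False
      then have degG_less: "\<And>v. v \<in> X \<Longrightarrow> card {g \<in> G. v \<in> g} < t" by force
      obtain v where v: "v \<in> X" "real d / 4 \<le> real (card {e \<in> H. v \<in> e \<and> e \<subseteq> X})"
        using high_degree_vertex[OF X deg edges] large by auto
      define W where "W = insert v (N v)"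
      have W: "W \<subseteq> X" unfolding W_def using v N_sub[of v] by auto
      \<comment> \<open>The link of \<open>v\<close>: pairs that an independent set through
        \<open>v\<close> cannot contain. By linearity they are disjoint, so adding them raises a
        degree by at most one, from below \<open>t\<close> to at most \<open>t\<close>.\<close>
      define L where "L = {g. v \<notin> g \<and> insert v g \<in> H \<and> g \<subseteq> X}"
      define L' where "L' = {g \<in> L. g \<inter> W = {}}"
      define G' where "G' = {g \<in> G. g \<inter> W = {}} \<union> L'"
      have finL: "finite L" by (rule finite_subset[of _ "Pow X"]) (auto simp: L_def finX)
      have finL': "finite L'" unfolding L'_def using finL by simp
      have L_unique: "g = g'" if "g \<in> L" "g' \<in> L" "u \<in> g" "u \<in> g'" for g g' u
      proof -
        have "insert v g = insert v g'" using that linear[of "insert v g" "insert v g'" v u]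
          unfolding L_def by auto
        then show ?thesis using that unfolding L_def by (auto simp: insert_ident)
      qed
      have L_deg: "card {g \<in> L. u \<in> g} \<le> 1" for u
        using L_unique finL by (subst One_nat_def, subst card_le_Suc0_iff_eq) auto
      have card_L: "card L = card {e \<in> H. v \<in> e \<and> e \<subseteq> X}"
      proof (rule bij_betw_same_card[of "insert v"])
        show "bij_betw (insert v) L {e \<in> H. v \<in> e \<and> e \<subseteq> X}"
        proof (rule bij_betwI')
          show "(insert v g = insert v g') = (g = g')" if "g \<in> L" "g' \<in> L" for g g'
            using that unfolding L_def by (auto simp: insert_ident)
          show "insert v g \<in> {e \<in> H. v \<in> e \<and> e \<subseteq> X}" if "g \<in> L" for g
            using that v(1) unfolding L_def by auto
          show "\<exists>g\<in>L. e = insert v g" if "e \<in> {e \<in> H. v \<in> e \<and> e \<subseteq> X}" for e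
            using that unfolding L_def by (intro bexI[of _ "e - {v}"]) (auto simp: insert_absorb)
        qed
      qed
      have "card L \<le> card L' + 1 * card (N v)"
      proof -
        have "L' = {g \<in> L. g \<inter> N v = {}}" unfolding L'_def W_def L_def by auto
        then show ?thesis
          using card_delete_vertices[of "N v" L 1] L_deg finL N_sub[of v] finX
          by (metis finite_Diff finite_subset)
      qed
      moreover have "card (N v) < t" using card_N degG_less v(1) by simp
      ultimately have card_L': "real d / 4 - real t \<le> real (card L')"
        using v(2) card_L by linarith
      \<comment> \<open>A pair of \<open>G\<close> lies in a triple with a point outside
        \<open>X\<close>, so by linearity in none with \<open>v\<close>. Hence every link pair
        counts as a new edge in the potential.\<close>
      have "G \<inter> L = {}"
      proof (rule ccontr)
        assume "G \<inter> L \<noteq> {}"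
        then obtain g where g: "g \<in> G" "g \<in> L" by blast
        then obtain w where w: "w \<in> A - X" "insert w g \<in> H" using G by blast
        obtain x y where xy: "g = {x, y}" "x \<noteq> y" using G[OF g(1)] by (meson card_2_iff)
        have "insert w g = insert v g"
          using linear[of "insert w g" "insert v g" x y] w g xy unfolding L_def by auto
        then have "w \<in> insert v g" by (metis insertI1)
        then show False using v(1) w(1) G[OF g(1)] by auto
      qed
      then have "card G' = card {g \<in> G. g \<inter> W = {}} + card L'"
        unfolding G'_def using finG finL' by (intro card_Un_disjoint) (auto simp: L'_def)
      then have "\<mu> (X - W) G' = \<mu> (X - W) {g \<in> G. g \<inter> W = {}} - real (card L')"
        unfolding \<mu>_def by simp
      \<comment> \<open>Deleting \<open>v\<close> gains \<open>t\<close>, which pays for the link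
        pairs destroyed by its fewer than \<open>t\<close> neighbours; a drop of
        \<open>d / 4\<close> remains.\<close>
      moreover have "real t * 1 \<le> real t * real (card W)"
        unfolding W_def card_W by (intro mult_left_mono) auto
      moreover have "(real t)\<^sup>2 \<le> real d" using t(2) by (metis of_nat_le_iff of_nat_power)
      ultimately have drop: "\<mu> (X - W) G' \<le> \<mu> X G - (real t)\<^sup>2 / 4"
        using delete[OF W] card_L' by linarith
      have "has_containers (H \<union> G) X (exp (\<rho> * (\<mu> X G / real t)))
       (11 / 12 * real (card A) + 4 * \<mu> X G / (real t)\<^sup>2)"
      proof (rule main[OF v(1) _ _ _ drop])
        show "X - W \<subseteq> X - {v}" unfolding W_def by auto
        fix g assume "g \<in> G'"
        then consider "g \<in> {g \<in> G. g \<inter> W = {}}" | "g \<in> L'" unfolding G'_def by blast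
        then show "g \<subseteq> X - W \<and> card g = 2 \<and> (\<exists>w\<in>A - (X - W). insert w g \<in> H)"
        proof cases
          case 1 then show ?thesis by (rule delete_G)
        next
          case 2
          then have g: "v \<notin> g" "insert v g \<in> H" "g \<subseteq> X - W" unfolding L'_def L_def by auto
          have "finite g" using g(3) finX by (meson finite_Diff finite_subset)
          then have "card g = 2" using triple_card[OF g(2)] g(1) by simp
          then show ?thesis using g v(1) X unfolding W_def by blast
        qed
      next
        fix w assume w: "w \<in> X - W"
        have "{g \<in> G'. w \<in> g} \<subseteq> {g \<in> G. w \<in> g} \<union> {g \<in> L. w \<in> g}"
          unfolding G'_def L'_def by auto
        then have "card {g \<in> G'. w \<in> g} \<le> card ({g \<in> G. w \<in> g} \<union> {g \<in> L. w \<in> g})"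
          using finG finL by (intro card_mono) auto
        also have "\<dots> \<le> card {g \<in> G. w \<in> g} + card {g \<in> L. w \<in> g}" by (rule card_Un_le)
        also have "\<dots> \<le> t" using L_deg[of w] degG_less[of w] w by auto
        finally show "card {g \<in> G'. w \<in> g} \<le> t" .
      next
        fix I assume I: "I \<subseteq> X" "v \<in> I" "independent_in (H \<union> G) I"
        have "u \<notin> I" if "u \<in> N v" for u
          using that I unfolding N_def independent_in_def by (metis UnI2 empty_subsetI insert_subset mem_Collect_eq)
        moreover have "\<not> g \<subseteq> I - {v}" if "g \<in> H \<union> G'" for g
        proof (cases "g \<in> L'")
          case True
          then have "insert v g \<in> H" unfolding L'_def L_def by auto
          then show ?thesis using I(2,3) unfolding independent_in_def by blast
        next
          case False
          then have "g \<in> H \<union> G" using that unfolding G'_def by auto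
          then show ?thesis using I(3) unfolding independent_in_def by blast
        qed
        ultimately show "I - {v} \<subseteq> X - W \<and> independent_in (H \<union> G') (I - {v})"
          using I(1) unfolding W_def independent_in_def by blast
      qed
      then show ?thesis unfolding \<mu>_def .
    qed
  qed
qed

theorem containers_shrink:
  fixes t d :: nat
  assumes deg: "\<And>v. v \<in> A \<Longrightarrow> card {e \<in> H. v \<in> e} \<le> d"
    and edges: "real d * real (card A) / 6 \<le> real (card H)"
    and t: "192 \<le> t" "t\<^sup>2 \<le> d"
  shows "has_containers H A (exp (16 * real (card A) * ln (real t) / real t)) (23 / 24 * real (card A))"
proof -
  define T where "T = real t / 4"
  \<comment> \<open>Half of the smallness \<open>\<rho>\<close> gained in
    \<open>exp (- \<rho>) <= 1 - \<rho> / 2\<close> suffices to cover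
    \<open>exp (- \<rho> * T)\<close>, which equals \<open>1 / T\<^sup>2\<close>. The logarithm is
    the price for the very unequal drops 1 and \<open>T\<close>.\<close>
  define \<rho> where "\<rho> = 2 * ln T / T"
  have T: "48 \<le> T" using t(1) unfolding T_def by simp
  have "exp 1 \<le> T" using exp_le T by linarith
  then have lnT: "1 \<le> ln T" using T by (simp add: ln_ge_iff)
  have \<rho>0: "0 < \<rho>" unfolding \<rho>_def using T lnT by simp
  have "ln (T / 2) \<le> T / 2 - 1" using T by (intro ln_le_minus_one) auto
  then have "2 * ln T \<le> T" using T ln_2_less_1 by (simp add: ln_div)
  then have \<rho>1: "\<rho> \<le> 1" unfolding \<rho>_def using T by (simp add: field_simps)
  have "exp (- \<rho>) = 1 / exp \<rho>" by (simp add: exp_minus field_simps)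
  also have "\<dots> \<le> 1 / (1 + \<rho>)" using exp_ge_add_one_self[of \<rho>] \<rho>0 by (intro divide_left_mono) auto
  also have "\<dots> \<le> 1 - \<rho> / 2"
  proof -
    have "\<rho> * \<rho> \<le> \<rho> * 1" using \<rho>0 \<rho>1 by (intro mult_left_mono) auto
    then have "1 \<le> (1 - \<rho> / 2) * (1 + \<rho>)" by (simp add: algebra_simps)
    then show ?thesis using \<rho>0 by (simp add: divide_le_eq)
  qed
  finally have "exp (- \<rho>) \<le> 1 - \<rho> / 2" .
  moreover have "exp (- \<rho> * T) \<le> \<rho> / 2"
  proof -
    have "exp (- \<rho> * T) = exp (- (ln T + ln T))" unfolding \<rho>_def using T by simp
    also have "\<dots> = 1 / (exp (ln T) * exp (ln T))"
      unfolding exp_minus exp_add by (simp add: divide_simps)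
    also have "\<dots> = 1 / (T * T)" using T by simp
    also have "\<dots> \<le> 1 / T" using T by (intro divide_left_mono) auto
    also have "\<dots> \<le> \<rho> / 2" unfolding \<rho>_def using lnT T by (simp add: divide_right_mono)
    finally show ?thesis .
  qed
  ultimately have \<rho>: "exp (- \<rho>) + exp (- \<rho> * (real t / 4)) \<le> 1" unfolding T_def[symmetric] by linarith
  have t0: "0 < t" using t(1) by simp
  have "has_containers (H \<union> {}) A
          (exp (\<rho> * ((2 * real t * real (card A) - real (card ({} :: 'a set set))) / real t)))
          (11 / 12 * real (card A) + 4 * (2 * real t * real (card A) - real (card ({} :: 'a set set))) / (real t)\<^sup>2)"
    by (rule containers_branching[OF deg edges t0 t(2) \<rho>0 \<rho>]) auto
  then show ?thesis
  proof (rule has_containers_mono)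
    have "\<rho> * ((2 * real t * real (card A)) / real t) = 16 * real (card A) * ln T / real t"
      unfolding \<rho>_def T_def using t0 by (simp add: field_simps)
    also have "\<dots> \<le> 16 * real (card A) * ln (real t) / real t"
      using T t0 unfolding T_def by (intro divide_right_mono mult_left_mono) auto
    finally show "exp (\<rho> * ((2 * real t * real (card A) - real (card ({} :: 'a set set))) / real t))
        \<le> exp (16 * real (card A) * ln (real t) / real t)" by simp
    \<comment> \<open>The included vertices number at most \<open>8 * card A / t\<close>; the bound
      192 makes this at most the \<open>card A / 24\<close> separating 11/12 from 23/24.\<close>
    have "4 * (2 * real t * real (card A)) / (real t)\<^sup>2 = 8 * real (card A) / real t"
      using t0 by (simp add: field_simps power2_eq_square)
    also have "\<dots> \<le> 8 * real (card A) / 192" using t by (intro divide_left_mono) auto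
    finally show "11 / 12 * real (card A) + 4 * (2 * real t * real (card A) - real (card ({} :: 'a set set))) / (real t)\<^sup>2
        \<le> 23 / 24 * real (card A)" by simp
  qed auto
qed

end

section \<open>Collinear triples in the grid\<close>

type_synonym point3 = "int \<times> int \<times> int"

definition grid :: "nat \<Rightarrow> point3 set" where
  "grid N = {0..<int N} \<times> {0..<int N} \<times> {0..<int N}"

text \<open>The cross product of the differences from the first point vanishes; triples with a
  repeated point qualify.\<close>

fun aligned :: "point3 \<Rightarrow> point3 \<Rightarrow> point3 \<Rightarrow> bool" where
  "aligned (x, y, z) (x', y', z') (x'', y'', z'') \<longleftrightarrow>
     (y' - y) * (z'' - z) = (z' - z) * (y'' - y) \<and>
     (z' - z) * (x'' - x) = (x' - x) * (z'' - z) \<and>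
     (x' - x) * (y'' - y) = (y' - y) * (x'' - x)"

definition aligned_set :: "point3 set \<Rightarrow> bool" where
  "aligned_set S \<longleftrightarrow> (\<forall>p\<in>S. \<forall>q\<in>S. \<forall>r\<in>S. aligned p q r)"

definition aligned_subsets :: "nat \<Rightarrow> point3 set \<Rightarrow> point3 set set" where
  "aligned_subsets k A = {e. e \<subseteq> A \<and> card e = k \<and> aligned_set e}"

text \<open>Positive coordinates choose one of two opposite primitive vectors, and they make every
  coordinate increase along a line, as the divisions in \<open>chain_start\<close> require.\<close>

definition directions :: "nat \<Rightarrow> point3 set" where
  "directions R = {(a, b, c). a \<in> {1..int R} \<and> b \<in> {1..int R} \<and> c \<in> {1..int R} \<and> gcd a (gcd b c) = 1}"

lemma finite_grid: "finite (grid N)" and card_grid: "card (grid N) = N ^ 3"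
  unfolding grid_def by (auto simp: card_cartesian_product power3_eq_cube)

lemma finite_directions: "finite (directions R)"
  by (rule finite_subset[of _ "{1..int R} \<times> {1..int R} \<times> {1..int R}"]) (auto simp: directions_def)

section \<open>The number of primitive directions\<close>

lemma sum_inverse_cubes_le:
  assumes "1 \<le> R"
  shows "(\<Sum>g=2..R. 1 / real g ^ 3) \<le> 1 / 2 - 1 / (2 * real R)"
  using assms
proof (induction R rule: dec_induct)
  case base
  then show ?case by simp
next
  case (step R)
  have R: "0 < real R" using step.hyps by simp
  \<comment> \<open>This yields \<open>1 / g^3 <= 1 / (2 * (g - 1) * g)\<close> for
    \<open>g = Suc R\<close>, a telescoping bound; the subtracted term of the statement carries the
    induction.\<close>
  have "2 * real R * real (Suc R) \<le> real (Suc R) ^ 3"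
    using R by (simp add: power3_eq_cube algebra_simps)
  then have "1 / real (Suc R) ^ 3 \<le> 1 / (2 * real R * real (Suc R))"
    using R by (intro divide_left_mono) auto
  also have "\<dots> = 1 / (2 * real R) - 1 / (2 * real (Suc R))"
    using R by (simp add: field_simps)
  finally show ?case using step by simp
qed

text \<open>A vector of the box with gcd \<open>g\<close> is \<open>g\<close> times a vector of the
  box of side \<open>R div g\<close>. So the imprimitive vectors number at most \<open>R^3\<close>
  times the sum of \<open>1 / g^3\<close> over \<open>g >= 2\<close>, which is at most 1/2.\<close>

lemma card_directions_ge: "real R ^ 3 / 2 \<le> real (card (directions R))"
proof (cases "R = 0")
  case False
  define B where "B = (\<lambda>n. {1..int n} \<times> {1..int n} \<times> {1..int n})"
  define m where "m = (\<lambda>g :: nat. \<lambda>(a, b, c). (int g * a, int g * b, int g * c) :: point3)"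
  have card_B: "card (B n) = n ^ 3" for n
    unfolding B_def by (simp add: card_cartesian_product power3_eq_cube)
  have fin_B: "finite (B n)" for n unfolding B_def by simp
  have "B R \<subseteq> directions R \<union> (\<Union>g\<in>{2..R}. m g ` B (R div g))"
  proof
    fix v assume v: "v \<in> B R"
    obtain a b c where abc: "v = (a, b, c)" by (cases v)
    have r: "1 \<le> a" "a \<le> int R" "1 \<le> b" "b \<le> int R" "1 \<le> c" "c \<le> int R"
      using v unfolding B_def abc by auto
    define g where "g = nat (gcd a (gcd b c))"
    have g: "int g = gcd a (gcd b c)" unfolding g_def by simp
    have gpos: "0 < gcd a (gcd b c)" using r by (simp add: gcd_pos_int)
    show "v \<in> directions R \<union> (\<Union>g\<in>{2..R}. m g ` B (R div g))"
    proof (cases "g = 1")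
      case True
      then show ?thesis using r g unfolding directions_def abc by auto
    next
      case False
      have g2: "2 \<le> g" using False gpos g by linarith
      have dv: "int g dvd a" "int g dvd b" "int g dvd c" unfolding g
        by (auto intro: gcd_dvd1 dvd_trans[OF gcd_dvd2])
      have gR: "g \<le> R" using zdvd_imp_le[OF dv(1)] r by linarith
      have bound: "\<exists>y. x = int g * y \<and> y \<in> {1..int (R div g)}" if dvd: "int g dvd x" and x: "1 \<le> x" "x \<le> int R" for x
      proof -
        obtain y where y: "x = int g * y" using dvd by blast
        have "0 < int g * y" using x(1) y by linarith
        then have "1 \<le> y" using g2 by (simp add: zero_less_mult_iff)
        moreover have "int g * y div int g \<le> int R div int g"
          using x(2) y g2 by (intro zdiv_mono1) auto
        then have "y \<le> int R div int g" using g2 by simp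
        ultimately show ?thesis using y by (auto simp: zdiv_int)
      qed
      obtain a' b' c' where "a = int g * a'" "a' \<in> {1..int (R div g)}" "b = int g * b'" "b' \<in> {1..int (R div g)}"
        "c = int g * c'" "c' \<in> {1..int (R div g)}"
        using bound[OF dv(1) r(1,2)] bound[OF dv(2) r(3,4)] bound[OF dv(3) r(5,6)] by blast
      then have "v \<in> m g ` B (R div g)" unfolding abc m_def B_def by force
      then show ?thesis using g2 gR by auto
    qed
  qed
  then have "card (B R) \<le> card (directions R \<union> (\<Union>g\<in>{2..R}. m g ` B (R div g)))"
    using fin_B finite_directions by (intro card_mono) auto
  also have "\<dots> \<le> card (directions R) + card (\<Union>g\<in>{2..R}. m g ` B (R div g))" by (rule card_Un_le)
  also have "card (\<Union>g\<in>{2..R}. m g ` B (R div g)) \<le> (\<Sum>g=2..R. card (m g ` B (R div g)))"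
    by (rule card_UN_le) auto
  also have "\<dots> \<le> (\<Sum>g=2..R. (R div g) ^ 3)"
    using card_image_le[OF fin_B] unfolding card_B by (intro sum_mono)
  finally have "real (R ^ 3) \<le> real (card (directions R) + (\<Sum>g=2..R. (R div g) ^ 3))"
    unfolding card_B by (simp only: of_nat_le_iff)
  also have "\<dots> = real (card (directions R)) + (\<Sum>g=2..R. real (R div g) ^ 3)" by simp
  also have "(\<Sum>g=2..R. real (R div g) ^ 3) \<le> (\<Sum>g=2..R. real R ^ 3 * (1 / real g ^ 3))"
  proof (rule sum_mono)
    fix g :: nat
    have "real (R div g) ^ 3 \<le> (real R / real g) ^ 3" by (intro power_mono of_nat_div_le_of_nat) auto
    then show "real (R div g) ^ 3 \<le> real R ^ 3 * (1 / real g ^ 3)" by (simp add: power_divide)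
  qed
  also have "\<dots> = real R ^ 3 * (\<Sum>g=2..R. 1 / real g ^ 3)" by (rule sum_distrib_left[symmetric])
  also have "\<dots> \<le> real R ^ 3 * (1 / 2)"
  proof (rule mult_left_mono)
    have "0 \<le> 1 / (2 * real R)" by simp
    moreover have "1 \<le> R" using False by simp
    ultimately show "(\<Sum>g=2..R. 1 / real g ^ 3) \<le> 1 / 2" using sum_inverse_cubes_le[of R] by linarith
  qed simp
  finally show ?thesis by simp
qed simp

text \<open>Walks back along the direction as far as the coordinates stay nonnegative. The end point
  labels the line, so that lines of one direction become fibres of a function.\<close>

fun chain_start :: "point3 \<Rightarrow> point3 \<Rightarrow> point3" where
  "chain_start (a, b, c) (x, y, z) =
     (let k = min (x div a) (min (y div b) (z div c)) in (x - k * a, y - k * b, z - k * c))"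

lemma chain_start_eqD:
  assumes "chain_start (a, b, c) (x, y, z) = chain_start (a, b, c) (x', y', z')"
  obtains k where "x' - x = k * a" "y' - y = k * b" "z' - z = k * c"
proof -
  define k where "k = min (x div a) (min (y div b) (z div c))"
  define k' where "k' = min (x' div a) (min (y' div b) (z' div c))"
  have "x - k * a = x' - k' * a" "y - k * b = y' - k' * b" "z - k * c = z' - k' * c"
    using assms unfolding k_def k'_def by (simp_all add: Let_def)
  then have "x' - x = (k' - k) * a" "y' - y = (k' - k) * b" "z' - z = (k' - k) * c"
    by (simp_all add: algebra_simps)
  then show ?thesis by (rule that)
qed

text \<open>One more step back would make some coordinate negative, so a starting point has a
  coordinate below \<open>R\<close>: it lies in one of three slabs of \<open>R * N\<^sup>2\<close>
  points.\<close>

lemma card_chain_starts_le: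
  assumes v: "v \<in> directions R" and A: "A \<subseteq> grid N"
  shows "card (chain_start v ` A) \<le> 3 * R * N\<^sup>2"
proof -
  let ?r = "{0..<int R}" and ?n = "{0..<int N}"
  obtain a b c where abc: "v = (a, b, c)" by (cases v)
  have r: "1 \<le> a" "a \<le> int R" "1 \<le> b" "b \<le> int R" "1 \<le> c" "c \<le> int R"
    using v unfolding directions_def abc by auto
  have "chain_start v ` A \<subseteq> ?r \<times> ?n \<times> ?n \<union> ?n \<times> ?r \<times> ?n \<union> ?n \<times> ?n \<times> ?r"
  proof
    fix s assume "s \<in> chain_start v ` A"
    then obtain p where p: "p \<in> A" "s = chain_start v p" by blast
    obtain x y z where xyz: "p = (x, y, z)" by (cases p)
    have n: "0 \<le> x" "x < int N" "0 \<le> y" "y < int N" "0 \<le> z" "z < int N"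
      using p A unfolding xyz grid_def by auto
    define k where "k = min (x div a) (min (y div b) (z div c))"
    have s: "s = (x - k * a, y - k * b, z - k * c)" unfolding p xyz abc k_def by (simp add: Let_def)
    have k0: "0 \<le> k" unfolding k_def using n r by (simp add: pos_imp_zdiv_nonneg_iff)
    have le: "k * a \<le> x" "k * b \<le> y" "k * c \<le> z"
    proof -
      have "k * a \<le> x div a * a" "k * b \<le> y div b * b" "k * c \<le> z div c * c"
        using r unfolding k_def by (auto intro!: mult_right_mono)
      then show "k * a \<le> x" "k * b \<le> y" "k * c \<le> z"
        using r pos_mod_sign[of a x] pos_mod_sign[of b y] pos_mod_sign[of c z]
          div_mult_mod_eq[of x a] div_mult_mod_eq[of y b] div_mult_mod_eq[of z c] by linarith+
    qed
    have nonneg: "0 \<le> k * a" "0 \<le> k * b" "0 \<le> k * c" using k0 r by simp_all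
    consider "k = x div a" | "k = y div b" | "k = z div c" unfolding k_def by linarith
    then have "x - k * a < int R \<or> y - k * b < int R \<or> z - k * c < int R"
    proof cases
      case 1
      then have "x - k * a = x mod a" by (simp add: minus_div_mult_eq_mod)
      then show ?thesis using r pos_mod_bound[of a x] by linarith
    next
      case 2
      then have "y - k * b = y mod b" by (simp add: minus_div_mult_eq_mod)
      then show ?thesis using r pos_mod_bound[of b y] by linarith
    next
      case 3
      then have "z - k * c = z mod c" by (simp add: minus_div_mult_eq_mod)
      then show ?thesis using r pos_mod_bound[of c z] by linarith
    qed
    then show "s \<in> ?r \<times> ?n \<times> ?n \<union> ?n \<times> ?r \<times> ?n \<union> ?n \<times> ?n \<times> ?r"
      unfolding s using n le nonneg by auto
  qed
  then have "card (chain_start v ` A) \<le> card (?r \<times> ?n \<times> ?n \<union> ?n \<times> ?r \<times> ?n \<union> ?n \<times> ?n \<times> ?r)"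
    by (rule card_mono[rotated]) auto
  also have "\<dots> \<le> card (?r \<times> ?n \<times> ?n \<union> ?n \<times> ?r \<times> ?n) + card (?n \<times> ?n \<times> ?r)"
    by (rule card_Un_le)
  also have "\<dots> \<le> card (?r \<times> ?n \<times> ?n) + card (?n \<times> ?r \<times> ?n) + card (?n \<times> ?n \<times> ?r)"
    by (intro add_right_mono card_Un_le)
  also have "\<dots> = 3 * R * N\<^sup>2" by (simp add: card_cartesian_product power2_eq_square)
  finally show ?thesis .
qed

text \<open>Taking gcds of both multiples gives equality of \<open>k\<close> and \<open>l\<close> up
  to sign; the positive first coordinates settle the sign.\<close>

lemma primitive_direction_unique:
  fixes a b c a' b' c' k l :: int
  assumes "(a, b, c) \<in> directions R" "(a', b', c') \<in> directions R"
    and eq: "k * a = l * a'" "k * b = l * b'" "k * c = l * c'" and k: "k \<noteq> 0"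
  shows "a = a' \<and> b = b' \<and> c = c'"
proof -
  have g: "gcd a (gcd b c) = 1" "gcd a' (gcd b' c') = 1" and pos: "0 < a" "0 < a'"
    using assms unfolding directions_def by auto
  have gcd_scale: "\<bar>m\<bar> * gcd x (gcd y z) = gcd (m * x) (gcd (m * y) (m * z))" for m x y z :: int
  proof -
    have "gcd (m * x) (gcd (m * y) (m * z)) = gcd (\<bar>m\<bar> * x) (gcd (\<bar>m\<bar> * y) (\<bar>m\<bar> * z))"
      by (cases "0 \<le> m") simp_all
    also have "\<dots> = \<bar>m\<bar> * gcd x (gcd y z)"
      using gcd_mult_distrib_int[of "\<bar>m\<bar>"] by simp
    finally show ?thesis by simp
  qed
  have "\<bar>k\<bar> * gcd a (gcd b c) = gcd (k * a) (gcd (k * b) (k * c))" by (rule gcd_scale)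
  also have "\<dots> = \<bar>l\<bar> * gcd a' (gcd b' c')" unfolding eq by (rule gcd_scale[symmetric])
  finally have "\<bar>k\<bar> = \<bar>l\<bar>" using g by simp
  moreover have "k \<noteq> - l"
  proof
    assume "k = - l"
    then have "l * (a + a') = 0" using eq(1) by (simp add: algebra_simps)
    then show False using pos k \<open>k = - l\<close> by simp
  qed
  ultimately have "k = l" by linarith
  then show ?thesis using eq k by simp
qed

definition fibre_triples :: "('a \<Rightarrow> 'b) \<Rightarrow> 'a set \<Rightarrow> 'a set set \<Rightarrow> bool" where
  "fibre_triples f A T \<longleftrightarrow>
     (\<forall>e\<in>T. e \<subseteq> A \<and> card e = 3 \<and> (\<forall>x\<in>e. \<forall>y\<in>e. f x = f y)) \<and> disjoint T"

lemma fibre_triplesD: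
  assumes "fibre_triples f A T" "e \<in> T"
  shows "e \<subseteq> A" "card e = 3" "\<And>x y. x \<in> e \<Longrightarrow> y \<in> e \<Longrightarrow> f x = f y"
    "\<And>e' x. e' \<in> T \<Longrightarrow> x \<in> e \<Longrightarrow> x \<in> e' \<Longrightarrow> e = e'"
  using assms unfolding fibre_triples_def disjoint_def by blast+

text \<open>Greedy: split off triples inside fibres until each fibre retains at most two
  points.\<close>

lemma many_fibre_triples:
  assumes "finite A"
  shows "\<exists>T. fibre_triples f A T \<and> card A \<le> 3 * card T + 2 * card (f ` A)"
  using assms
proof (induction A rule: finite_psubset_induct)
  case (psubset A)
  show ?case
  proof (cases "\<exists>e\<subseteq>A. card e = 3 \<and> (\<forall>x\<in>e. \<forall>y\<in>e. f x = f y)")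
    case True
    then obtain e where e: "e \<subseteq> A" "card e = 3" "\<forall>x\<in>e. \<forall>y\<in>e. f x = f y" by blast
    have fin_e: "finite e" and "e \<noteq> {}" using e by (auto intro: card_ge_0_finite)
    then have "A - e \<subset> A" using e(1) by blast
    from psubset.IH[OF this] obtain T where T: "fibre_triples f (A - e) T"
      "card (A - e) \<le> 3 * card T + 2 * card (f ` (A - e))" by blast
    have finT: "finite T"
      by (rule finite_subset[of _ "Pow A"]) (use fibre_triplesD(1)[OF T(1)] psubset.hyps in auto)
    have T_e: "e' \<inter> e = {}" if "e' \<in> T" for e' using fibre_triplesD(1)[OF T(1) that] by blast
    then have "e \<notin> T" using \<open>e \<noteq> {}\<close> by fastforce
    then have cT: "card (insert e T) = Suc (card T)" using finT by simp
    have "card (f ` (A - e)) \<le> card (f ` A)" using psubset.hyps by (intro card_mono) auto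
    moreover have "card A = card (A - e) + 3"
      using e fin_e psubset.hyps by (metis card_Diff_subset card_mono le_add_diff_inverse2)
    ultimately have "card A \<le> 3 * card (insert e T) + 2 * card (f ` A)" using T(2) cT by linarith
    moreover have "fibre_triples f A (insert e T)"
      unfolding fibre_triples_def
    proof
      show "\<forall>e'\<in>insert e T. e' \<subseteq> A \<and> card e' = 3 \<and> (\<forall>x\<in>e'. \<forall>y\<in>e'. f x = f y)"
        using T(1) e unfolding fibre_triples_def by blast
      show "disjoint (insert e T)"
        using T(1) T_e unfolding fibre_triples_def disjoint_def by (auto simp: Int_commute)
    qed
    ultimately show ?thesis by blast
  next
    case False
    have "card {x \<in> A. f x = y} \<le> 2" for y
    proof (rule ccontr)
      assume "\<not> card {x \<in> A. f x = y} \<le> 2"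
      then have "3 \<le> card {x \<in> A. f x = y}" by simp
      then obtain e where "e \<subseteq> {x \<in> A. f x = y}" "card e = 3" by (meson obtain_subset_with_card_n)
      then show False using False by blast
    qed
    then have "(\<Sum>y\<in>f ` A. card {x \<in> A. f x = y}) \<le> (\<Sum>y\<in>f ` A. 2)" by (intro sum_mono)
    moreover have "A = (\<Union>y\<in>f ` A. {x \<in> A. f x = y})" by blast
    then have "card A \<le> (\<Sum>y\<in>f ` A. card {x \<in> A. f x = y})"
      using card_UN_le[of "f ` A" "\<lambda>y. {x \<in> A. f x = y}"] psubset.hyps by simp
    ultimately have "card A \<le> 3 * card {} + 2 * card (f ` A)" by simp
    moreover have "fibre_triples f A {}" unfolding fibre_triples_def disjoint_def by simp
    ultimately show ?thesis by blast
  qed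
qed

text \<open>Splitting the points of \<open>A\<close> on every line of a given direction into disjoint triples,
  instead of taking all collinear triples, makes the triple system linear and almost regular.\<close>

lemma grid_triple_system:
  assumes A: "A \<subseteq> grid N" and large: "12 * R * N\<^sup>2 \<le> card A"
  obtains H where "linear_triple_system A H" "H \<subseteq> aligned_subsets 3 A"
    "\<And>v. v \<in> A \<Longrightarrow> card {e \<in> H. v \<in> e} \<le> card (directions R)"
    "real (card (directions R)) * real (card A) / 6 \<le> real (card H)"
proof -
  let ?D = "directions R"
  have finA: "finite A" using A finite_grid finite_subset by blast
  obtain T where fT: "\<And>v. fibre_triples (chain_start v) A (T v)"
    and T_card: "\<And>v. card A \<le> 3 * card (T v) + 2 * card (chain_start v ` A)"
  proof -
    have "\<forall>v. \<exists>T. fibre_triples (chain_start v) A T \<and> card A \<le> 3 * card T + 2 * card (chain_start v ` A)"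
      using many_fibre_triples[OF finA] by blast
    from choice[OF this] show ?thesis using that by blast
  qed
  note T = fibre_triplesD(1,2)[OF fT] and T_chain = fibre_triplesD(3)[OF fT]
    and T_disj = fibre_triplesD(4)[OF fT]
  have finT: "finite (T v)" for v
  proof (rule finite_subset)
    show "T v \<subseteq> Pow A" using T(1) by blast
  qed (use finA in simp)
  define H where "H = (\<Union>v\<in>?D. T v)"
  \<comment> \<open>Two common points determine the primitive direction. This gives linearity across
    directions and, further below, that no triple is counted for two directions.\<close>
  have same_dir: "v = w" if v: "v \<in> ?D" "w \<in> ?D" and e: "e \<in> T v" "e' \<in> T w"
    and xy: "x \<in> e" "x \<in> e'" "y \<in> e" "y \<in> e'" "x \<noteq> y" for v w e e' x y
  proof -
    obtain a b c where abc: "v = (a, b, c)" by (cases v)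
    obtain a' b' c' where abc': "w = (a', b', c')" by (cases w)
    obtain x1 x2 x3 where x: "x = (x1, x2, x3)" by (cases x)
    obtain y1 y2 y3 where y: "y = (y1, y2, y3)" by (cases y)
    obtain k where k: "y1 - x1 = k * a" "y2 - x2 = k * b" "y3 - x3 = k * c"
      using T_chain[OF e(1) xy(1,3)] unfolding x y abc by (rule chain_start_eqD)
    obtain l where l: "y1 - x1 = l * a'" "y2 - x2 = l * b'" "y3 - x3 = l * c'"
      using T_chain[OF e(2) xy(2,4)] unfolding x y abc' by (rule chain_start_eqD)
    have "k \<noteq> 0" using k xy(5) unfolding x y by auto
    then show ?thesis
      using primitive_direction_unique[of a b c R a' b' c' k l] v k l unfolding abc abc' by simp
  qed
  have lin: "linear_triple_system A H"
  proof
    show "finite A" by (rule finA)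
    show "e \<subseteq> A" "card e = 3" if "e \<in> H" for e using that T unfolding H_def by blast+
    fix e e' x y assume "e \<in> H" "e' \<in> H" and xy: "x \<in> e" "x \<in> e'" "y \<in> e" "y \<in> e'" "x \<noteq> y"
    then obtain v w where "v \<in> ?D" "w \<in> ?D" "e \<in> T v" "e' \<in> T w" unfolding H_def by blast
    moreover from this have "v = w" using same_dir xy by blast
    ultimately show "e = e'" using xy T_disj by blast
  qed
  moreover have "H \<subseteq> aligned_subsets 3 A"
  proof
    fix e assume "e \<in> H"
    then obtain v where v: "v \<in> ?D" "e \<in> T v" unfolding H_def by blast
    obtain a b c where abc: "v = (a, b, c)" by (cases v)
    have "aligned p q r" if mem: "p \<in> e" "q \<in> e" "r \<in> e" for p q r
    proof -
      obtain p1 p2 p3 where p: "p = (p1, p2, p3)" by (cases p)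
      obtain q1 q2 q3 where q: "q = (q1, q2, q3)" by (cases q)
      obtain r1 r2 r3 where r: "r = (r1, r2, r3)" by (cases r)
      obtain k where k: "q1 - p1 = k * a" "q2 - p2 = k * b" "q3 - p3 = k * c"
        using T_chain[OF v(2) mem(1,2)] unfolding p q abc by (rule chain_start_eqD)
      obtain l where l: "r1 - p1 = l * a" "r2 - p2 = l * b" "r3 - p3 = l * c"
        using T_chain[OF v(2) mem(1,3)] unfolding p r abc by (rule chain_start_eqD)
      show ?thesis unfolding p q r aligned.simps k l by (simp add: algebra_simps)
    qed
    then show "e \<in> aligned_subsets 3 A"
      using T v unfolding aligned_subsets_def aligned_set_def by auto
  qed
  moreover have "card {e \<in> H. x \<in> e} \<le> card ?D" for x
  proof -
    have "{e \<in> H. x \<in> e} = (\<Union>v\<in>?D. {e \<in> T v. x \<in> e})" unfolding H_def by blast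
    then have "card {e \<in> H. x \<in> e} \<le> (\<Sum>v\<in>?D. card {e \<in> T v. x \<in> e})"
      using card_UN_le[OF finite_directions, of "\<lambda>v. {e \<in> T v. x \<in> e}"] by simp
    also have "\<dots> \<le> (\<Sum>v\<in>?D. 1)"
    proof (rule sum_mono)
      fix v
      show "card {e \<in> T v. x \<in> e} \<le> 1"
        unfolding One_nat_def using finT T_disj by (subst card_le_Suc0_iff_eq) (simp, blast)
    qed
    finally show ?thesis by simp
  qed
  moreover have "real (card ?D) * real (card A) / 6 \<le> real (card H)"
  proof -
    have "T v \<inter> T w = {}" if vw: "v \<in> ?D" "w \<in> ?D" "v \<noteq> w" for v w
    proof (rule ccontr)
      assume "T v \<inter> T w \<noteq> {}"
      then obtain e where e: "e \<in> T v" "e \<in> T w" by blast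
      then have "card e = 3" using T by blast
      then obtain x y where "x \<in> e" "y \<in> e" "x \<noteq> y" unfolding card_3_iff by blast
      then show False using same_dir[OF vw(1,2) e] vw(3) by blast
    qed
    then have "card H = (\<Sum>v\<in>?D. card (T v))"
      unfolding H_def using finite_directions finT by (intro card_UN_disjoint) auto
    \<comment> \<open>The leftover points, two per line, number at most
      \<open>6 * R * N\<^sup>2\<close>, which is at most half of \<open>card A\<close>.\<close>
    moreover have "real (card A) / 6 \<le> real (card (T v))" if "v \<in> ?D" for v
      using T_card[of v] card_chain_starts_le[OF that A] large by linarith
    then have "(\<Sum>v\<in>?D. real (card A) / 6) \<le> (\<Sum>v\<in>?D. real (card (T v)))" by (rule sum_mono)
    ultimately show ?thesis by simp
  qed
  ultimately show ?thesis using that by blast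
qed

section \<open>Containers and collinear quadruples in the grid\<close>

lemma aligned_subsets_mono: "A \<subseteq> B \<Longrightarrow> aligned_subsets k A \<subseteq> aligned_subsets k B"
  unfolding aligned_subsets_def by auto

text \<open>\<open>R\<close> is taken as large as \<open>grid_triple_system\<close> permits. The
  degree bound is then at least \<open>R^3 / 2\<close>, so \<open>t\<close> can be of order
  \<open>R^(3/2)\<close>, and \<open>card A / t\<close> is of order \<open>q^6 / sqrt R\<close>;
  finally \<open>R >= q^2\<close> turns this into \<open>q^5\<close>.\<close>

lemma grid_containers_step:
  assumes q: "9 \<le> q" and A: "A \<subseteq> grid (q ^ 3)" and large: "12 * q ^ 8 \<le> card A"
  shows "has_containers (aligned_subsets 3 (grid (q ^ 3))) A (exp (7000 * real q ^ 5 * ln (real q))) (23 / 24 * real (card A))"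
proof -
  define R where "R = card A div (12 * q ^ 6)"
  define s where "s = sqrt (real R)"
  \<comment> \<open>The factor 1/2 puts \<open>t\<^sup>2\<close> below \<open>R^3 / 2\<close>. Since
    \<open>s >= q >= 9\<close>, the lower bound \<open>s^3 / 3\<close> is at least 243, above the
    192 that \<open>containers_shrink\<close> demands.\<close>
  define t where "t = nat \<lfloor>s ^ 3 / 2\<rfloor>"
  have q0: "0 < real q" using q by simp
  have cardA: "card A \<le> q ^ 9"
    using card_mono[OF finite_grid A] by (simp add: card_grid flip: power_mult)
  have N2: "(q ^ 3)\<^sup>2 = q ^ 6" by (simp flip: power_mult)
  have R_le: "12 * R * (q ^ 3)\<^sup>2 \<le> card A"
    unfolding R_def N2 using div_times_less_eq_dividend[of "card A" "12 * q ^ 6"] by (simp add: ac_simps)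
  have q8: "12 * q ^ 8 = q\<^sup>2 * (12 * q ^ 6)" by (simp flip: power_add)
  have "q\<^sup>2 = 12 * q ^ 8 div (12 * q ^ 6)"
    unfolding q8 by (rule nonzero_mult_div_cancel_right[symmetric]) (use q in simp)
  also have "\<dots> \<le> R" unfolding R_def by (intro div_le_mono large)
  finally have qR: "q\<^sup>2 \<le> R" .
  then have R1: "1 \<le> R" using q by (metis One_nat_def Suc_leI less_le_trans pos2 zero_less_power zero_less_numeral)
  have s2: "s\<^sup>2 = real R" unfolding s_def by simp
  have sq: "real q \<le> s" unfolding s_def using qR by (intro real_le_rsqrt) (metis of_nat_le_iff of_nat_power)
  have s9: "9 \<le> s" using sq q by linarith
  have "card A < 12 * q ^ 6 * (R + 1)"
    using q dividend_less_div_times[of "12 * q ^ 6" "card A"] unfolding R_def[symmetric]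
    by (simp add: algebra_simps)
  also have "\<dots> \<le> 12 * q ^ 6 * (2 * R)" using R1 by (intro mult_left_mono) auto
  finally have "card A \<le> 24 * q ^ 6 * R" by simp
  then have "real (card A) \<le> real (24 * q ^ 6 * R)" by (simp only: of_nat_le_iff)
  then have cA: "real (card A) \<le> 24 * real q ^ 6 * s\<^sup>2" unfolding s2 by simp
  have s_le: "s \<le> real q ^ 2"
  proof -
    have "12 * R * q ^ 6 \<le> q ^ 9" using order_trans[OF R_le cardA] unfolding N2 .
    also have "\<dots> = q ^ 3 * q ^ 6" by (simp flip: power_add)
    finally have "12 * R * q ^ 6 \<le> q ^ 3 * q ^ 6" .
    then have "12 * R \<le> q ^ 3"
      by (rule mult_le_cancel2[THEN iffD1, rule_format]) (use q in simp)
    also have "\<dots> \<le> q ^ 4" using q by (intro power_increasing) auto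
    finally have "R \<le> q ^ 4" by linarith
    then have "real R \<le> real (q ^ 4)" by (simp only: of_nat_le_iff)
    then have "real R \<le> real q ^ 4" by simp
    then show ?thesis unfolding s_def by (intro real_le_lsqrt) (simp_all flip: power_mult)
  qed
  have s3: "729 \<le> s ^ 3" using power_mono[OF s9, of 3] by simp
  have "0 \<le> \<lfloor>s ^ 3 / 2\<rfloor>" using s9 by simp
  then have t_floor: "real t = real_of_int \<lfloor>s ^ 3 / 2\<rfloor>" unfolding t_def by (rule of_nat_nat)
  have t_le: "real t \<le> s ^ 3 / 2" unfolding t_floor by (rule of_int_floor_le)
  have t_ge: "s ^ 3 / 3 \<le> real t" unfolding t_floor using s3 floor_correct[of "s ^ 3 / 2"] by linarith
  have t192: "192 \<le> t"
  proof -
    have "192 \<le> real t" using t_ge s3 by linarith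
    then show ?thesis by simp
  qed
  have t2: "t\<^sup>2 \<le> card (directions R)"
  proof -
    have "(real t)\<^sup>2 \<le> (s ^ 3 / 2)\<^sup>2" using t_le by (intro power_mono) auto
    also have "\<dots> = (s\<^sup>2) ^ 3 / 4" by (simp add: power_divide flip: power_mult)
    also have "\<dots> \<le> real R ^ 3 / 2" unfolding s2 by simp
    also have "\<dots> \<le> real (card (directions R))" by (rule card_directions_ge)
    finally show ?thesis by (metis of_nat_le_iff of_nat_power)
  qed
  obtain H where H: "linear_triple_system A H" "H \<subseteq> aligned_subsets 3 A"
    "\<And>v. v \<in> A \<Longrightarrow> card {e \<in> H. v \<in> e} \<le> card (directions R)"
    "real (card (directions R)) * real (card A) / 6 \<le> real (card H)"
    using grid_triple_system[OF A R_le] by blast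
  have "has_containers H A (exp (16 * real (card A) * ln (real t) / real t)) (23 / 24 * real (card A))"
    by (rule linear_triple_system.containers_shrink[OF H(1,3,4) t192 t2])
  then show ?thesis
  proof (rule has_containers_mono)
    have s0: "0 < s" using s9 by linarith
    have "real (card A) / real t \<le> (24 * real q ^ 6 * s\<^sup>2) / (s ^ 3 / 3)"
      using cA t_ge s0 t192 by (intro frac_le) auto
    also have "\<dots> = 72 * real q ^ 6 / s"
      using s0 by (simp add: field_simps power2_eq_square power3_eq_cube)
    also have "\<dots> \<le> 72 * real q ^ 6 / real q" using sq q0 by (intro divide_left_mono) auto
    also have "\<dots> = 72 * real q ^ 5"
    proof -
      have "real q ^ 6 = real q * real q ^ 5" by (simp flip: power_Suc)
      then show ?thesis using q0 by simp
    qed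
    finally have 1: "real (card A) / real t \<le> 72 * real q ^ 5" .
    have "s ^ 3 / 2 \<le> (real q ^ 2) ^ 3"
    proof -
      have "s ^ 3 \<le> (real q ^ 2) ^ 3" using s_le s0 by (intro power_mono) auto
      then show ?thesis using s3 by linarith
    qed
    moreover have "(real q ^ 2) ^ 3 = real q ^ 6" by (simp flip: power_mult)
    ultimately have "real t \<le> real q ^ 6" using t_le by linarith
    then have "ln (real t) \<le> ln (real q ^ 6)" using t192 by (subst ln_le_cancel_iff) (use q0 in auto)
    also have "\<dots> = 6 * ln (real q)" using q0 by (simp add: ln_realpow)
    finally have 2: "ln (real t) \<le> 6 * ln (real q)" .
    have "16 * real (card A) * ln (real t) / real t = 16 * (real (card A) / real t) * ln (real t)" by simp
    also have "\<dots> \<le> 16 * (72 * real q ^ 5) * (6 * ln (real q))"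
      using 1 2 t192 q by (intro mult_mono) auto
    \<comment> \<open>16 * 72 * 6 = 6912, rounded up.\<close>
    also have "\<dots> \<le> 7000 * real q ^ 5 * ln (real q)"
      using mult_nonneg_nonneg[of "real q ^ 5" "ln (real q)"] q by simp
    finally show "exp (16 * real (card A) * ln (real t) / real t) \<le> exp (7000 * real q ^ 5 * ln (real q))" by simp
    show "H \<subseteq> aligned_subsets 3 (grid (q ^ 3))" using H(2) aligned_subsets_mono[OF A] by blast
  qed simp
qed

lemma grid_containers_iterate:
  assumes q: "9 \<le> q"
  shows "A \<subseteq> grid (q ^ 3) \<Longrightarrow> real (card A) \<le> 12 * real q ^ 8 * (24 / 23) ^ j \<Longrightarrow>
    has_containers (aligned_subsets 3 (grid (q ^ 3))) A (exp (7000 * real q ^ 5 * ln (real q) * real j)) (12 * real q ^ 8)"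
proof (induction j arbitrary: A)
  case 0
  then show ?case by (intro has_containers_self) auto
next
  case (Suc j)
  let ?B = "7000 * real q ^ 5 * ln (real q)"
  have B0: "0 \<le> ?B" using q by simp
  show ?case
  proof (cases "real (card A) \<le> 12 * real q ^ 8")
    case True
    then show ?thesis using B0 by (intro has_containers_self) auto
  next
    case False
    then have "real (12 * q ^ 8) \<le> real (card A)" by simp
    then have "12 * q ^ 8 \<le> card A" by (simp only: of_nat_le_iff)
    then have "has_containers (aligned_subsets 3 (grid (q ^ 3))) A (exp ?B) (23 / 24 * real (card A))"
      by (rule grid_containers_step[OF q Suc.prems(1)])
    then have "has_containers (aligned_subsets 3 (grid (q ^ 3))) A (exp ?B * exp (?B * real j)) (12 * real q ^ 8)"
    proof (rule has_containers_compose)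
      fix Y assume Y: "Y \<subseteq> A" "real (card Y) \<le> 23 / 24 * real (card A)"
      show "has_containers (aligned_subsets 3 (grid (q ^ 3))) Y (exp (?B * real j)) (12 * real q ^ 8)"
      proof (rule Suc.IH)
        show "Y \<subseteq> grid (q ^ 3)" using Y Suc.prems by blast
        show "real (card Y) \<le> 12 * real q ^ 8 * (24 / 23) ^ j" using Y(2) Suc.prems(2) by simp
      qed
    qed simp
    moreover have "exp ?B * exp (?B * real j) = exp (?B * real (Suc j))"
      by (simp add: exp_add[symmetric] algebra_simps)
    ultimately show ?thesis by simp
  qed
qed

lemma grid_containers:
  assumes q: "9 \<le> q"
  shows "has_containers (aligned_subsets 3 (grid (q ^ 3))) (grid (q ^ 3))
           (exp (175000 * real q ^ 5 * (ln (real q))\<^sup>2)) (12 * real q ^ 8)"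
proof -
  \<comment> \<open>As \<open>ln (24 / 23) >= 1 / 24\<close>, this many rounds shrink by a factor of
    at least \<open>q\<close>, from \<open>q^9\<close> points to the target. With
    \<open>j <= 25 * ln q\<close> the constant becomes 7000 * 25 = 175000.\<close>
  define j where "j = nat \<lceil>24 * ln (real q)\<rceil>"
  have "exp 1 \<le> real q" using exp_le q by linarith
  then have ln1: "1 \<le> ln (real q)" using q by (simp add: ln_ge_iff)
  have "0 \<le> \<lceil>24 * ln (real q)\<rceil>" using ln1 by linarith
  then have "real j = real_of_int \<lceil>24 * ln (real q)\<rceil>" unfolding j_def by (rule of_nat_nat)
  then have j: "24 * ln (real q) \<le> real j" "real j \<le> 25 * ln (real q)"
    using ln1 ceiling_correct[of "24 * ln (real q)"] by linarith+
  have "ln (23 / 24 :: real) \<le> 23 / 24 - 1" by (rule ln_le_minus_one) simp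
  then have ln24: "1 / 24 \<le> ln (24 / 23 :: real)" by (simp add: ln_div)
  have "ln (real q) \<le> real j * (1 / 24)" using j(1) by simp
  also have "\<dots> \<le> real j * ln (24 / 23)" using ln24 by (intro mult_left_mono) auto
  also have "\<dots> = ln ((24 / 23) ^ j)" by (simp add: ln_realpow)
  finally have "real q \<le> (24 / 23) ^ j" using q by (subst (asm) ln_le_cancel_iff) auto
  then have "real q ^ 8 * real q \<le> real q ^ 8 * (24 / 23) ^ j" by (intro mult_left_mono) auto
  moreover have "real (card (grid (q ^ 3))) = real q ^ 8 * real q"
    by (simp add: card_grid flip: power_mult power_Suc2)
  moreover have "0 \<le> real q ^ 8 * (24 / 23) ^ j" by simp
  ultimately have "real (card (grid (q ^ 3))) \<le> 12 * real q ^ 8 * (24 / 23) ^ j" by linarith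
  from grid_containers_iterate[OF q order_refl this]
  show ?thesis
  proof (rule has_containers_mono)
    have "7000 * real q ^ 5 * ln (real q) * real j \<le> 7000 * real q ^ 5 * ln (real q) * (25 * ln (real q))"
      using j(2) ln1 by (intro mult_left_mono) auto
    then show "exp (7000 * real q ^ 5 * ln (real q) * real j) \<le> exp (175000 * real q ^ 5 * (ln (real q))\<^sup>2)"
      by (simp add: power2_eq_square algebra_simps)
  qed auto
qed

section \<open>Counting collinear quadruples\<close>

lemma aligned_parallel:
  assumes gcd1: "gcd a (gcd b c) = (1 :: int)"
    and "b * \<gamma> = c * \<beta>" "c * \<alpha> = a * \<gamma>" "a * \<beta> = b * \<alpha>"
  obtains k where "\<alpha> = k * a" "\<beta> = k * b" "\<gamma> = k * c"
proof -
  obtain u v where uv: "u * b + v * c = gcd b c" using bezout_int by blast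
  obtain x y where xy: "x * a + y * gcd b c = 1" using bezout_int[of a "gcd b c"] gcd1 by metis
  have 1: "x * a + y * u * b + y * v * c = 1" using xy unfolding uv[symmetric] by (simp add: algebra_simps)
  \<comment> \<open>The Bezout combination that sends \<open>(a, b, c)\<close> to 1, applied to the
    parallel vector, recovers the integral multiplier.\<close>
  define k where "k = x * \<alpha> + y * u * \<beta> + y * v * \<gamma>"
  have "k * a = x * a * \<alpha> + y * u * (a * \<beta>) + y * v * (a * \<gamma>)" unfolding k_def by (simp add: algebra_simps)
  also have "\<dots> = \<alpha> * (x * a + y * u * b + y * v * c)"
    unfolding assms(3)[symmetric] assms(4) by (simp add: algebra_simps)
  finally have ka: "k * a = \<alpha>" using 1 by simp
  have "k * b = x * (b * \<alpha>) + y * u * b * \<beta> + y * v * (b * \<gamma>)" unfolding k_def by (simp add: algebra_simps)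
  also have "\<dots> = \<beta> * (x * a + y * u * b + y * v * c)"
    unfolding assms(2) assms(4)[symmetric] by (simp add: algebra_simps)
  finally have kb: "k * b = \<beta>" using 1 by simp
  have "k * c = x * (c * \<alpha>) + y * u * (c * \<beta>) + y * v * c * \<gamma>" unfolding k_def by (simp add: algebra_simps)
  also have "\<dots> = \<gamma> * (x * a + y * u * b + y * v * c)"
    unfolding assms(3) assms(2)[symmetric] by (simp add: algebra_simps)
  finally have kc: "k * c = \<gamma>" using 1 by simp
  show ?thesis using that[of k] ka kb kc by simp
qed

fun translate :: "point3 \<Rightarrow> point3 \<Rightarrow> int \<Rightarrow> point3" where
  "translate (x, y, z) (a, b, c) k = (x + k * a, y + k * b, z + k * c)"

lemma aligned_translates: "aligned (translate p u i) (translate p u j) (translate p u k)"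
  by (cases p; cases u) (simp add: algebra_simps)

lemma aligned_direction:
  assumes "p \<noteq> q"
  obtains u where "u \<noteq> (0, 0, 0)" "\<And>w. aligned p q w \<Longrightarrow> \<exists>k. w = translate p u k"
proof -
  obtain x y z where p: "p = (x, y, z)" by (cases p)
  obtain x' y' z' where q: "q = (x', y', z')" by (cases q)
  define g where "g = gcd (x' - x) (gcd (y' - y) (z' - z))"
  have g0: "g > 0"
  proof -
    have "g \<noteq> 0" unfolding g_def using assms unfolding p q by auto
    moreover have "g \<ge> 0" unfolding g_def by simp
    ultimately show ?thesis by simp
  qed
  have "g dvd x' - x" "g dvd y' - y" "g dvd z' - z"
    unfolding g_def by (auto intro: gcd_dvd1 dvd_trans[OF gcd_dvd2])
  then obtain a b c where abc: "x' - x = g * a" "y' - y = g * b" "z' - z = g * c" by (metis dvdE)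
  have "g * gcd a (gcd b c) = g"
  proof -
    have "g * gcd a (gcd b c) = gcd (g * a) (gcd (g * b) (g * c))"
      using gcd_mult_distrib_int[of g] g0 by simp
    also have "\<dots> = g" by (simp only: abc[symmetric] g_def[symmetric])
    finally show ?thesis .
  qed
  then have gcd1: "gcd a (gcd b c) = 1" using g0 by simp
  have "\<exists>k. w = translate p (a, b, c) k" if w: "aligned p q w" for w
  proof -
    obtain w1 w2 w3 where w123: "w = (w1, w2, w3)" by (cases w)
    have "g * (b * (w3 - z)) = g * (c * (w2 - y))" "g * (c * (w1 - x)) = g * (a * (w3 - z))"
      "g * (a * (w2 - y)) = g * (b * (w1 - x))"
      using w unfolding p q w123 aligned.simps abc by (simp_all add: ac_simps)
    then have "b * (w3 - z) = c * (w2 - y)" "c * (w1 - x) = a * (w3 - z)" "a * (w2 - y) = b * (w1 - x)"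
      using g0 by simp_all
    with gcd1 obtain k where "w1 - x = k * a" "w2 - y = k * b" "w3 - z = k * c"
      by (rule aligned_parallel)
    then have "w = translate p (a, b, c) k" unfolding w123 p by (simp add: algebra_simps)
    then show ?thesis by blast
  qed
  moreover have "(a, b, c) \<noteq> (0, 0, 0)" using gcd1 by auto
  ultimately show ?thesis using that by blast
qed

text \<open>Both \<open>r\<close> and \<open>s\<close> are integral translates of \<open>p\<close>
  along the primitive vector of the line through \<open>p\<close> and \<open>q\<close>. The choice
  of \<open>p\<close> and \<open>q\<close> as the shared pair matches what the failure of
  \<open>no4\<close> provides later.\<close>

lemma aligned_quadruple:
  assumes "p \<noteq> q" "aligned p q r" "aligned p q s"
  shows "aligned_set {p, q, r, s}"
proof -
  obtain u where u: "\<And>w. aligned p q w \<Longrightarrow> \<exists>k. w = translate p u k" using aligned_direction[OF assms(1)] by blast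
  have "aligned p q p" "aligned p q q" by (cases p; cases q; simp)+
  then have "\<exists>k. w = translate p u k" if "w \<in> {p, q, r, s}" for w using u assms that by blast
  then show ?thesis unfolding aligned_set_def using aligned_translates by metis
qed

lemma sum_inverse_le_ln:
  assumes "1 \<le> N"
  shows "(\<Sum>s=1..N. 1 / real s) \<le> 1 + ln (real N)"
  using assms
proof (induction N rule: dec_induct)
  case base
  then show ?case by simp
next
  case (step N)
  have N: "0 < real N" using step.hyps by simp
  have "ln (real N / real (Suc N)) \<le> real N / real (Suc N) - 1" using N by (intro ln_le_minus_one) auto
  also have "\<dots> = - (1 / real (Suc N))" using N by (simp add: field_simps)
  finally have "1 / real (Suc N) \<le> ln (real (Suc N)) - ln (real N)" using N by (simp add: ln_div)
  then show ?case using step by simp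
qed

text \<open>A collinear quadruple is \<open>p\<close> together with three points \<open>p + i u\<close> for one vector \<open>u\<close>; there are
  \<open>O(s\<^sup>2)\<close> vectors \<open>u\<close> of maximum norm \<open>s\<close>, and then \<open>O(N / s)\<close> choices for each multiplier.\<close>

lemma card_aligned_quadruples_le:
  assumes N: "1 \<le> N"
  shows "real (card (aligned_subsets 4 (grid N))) \<le> 1458 * real N ^ 6 * (1 + ln (real N))"
proof -
  define J where "J = (\<lambda>s :: nat. {- int s..int s})"
  \<comment> \<open>The integer vectors of maximum norm exactly \<open>s\<close>, grouped by the
    coordinate that attains it.\<close>
  define F where "F = (\<lambda>s :: nat. {- int s, int s} \<times> J s \<times> J s \<union> J s \<times> {- int s, int s} \<times> J s \<union> J s \<times> J s \<times> {- int s, int s})"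
  define I where "I = (\<lambda>s :: nat. J (N div s))"
  define \<Phi> where "\<Phi> = (\<lambda>(p, u, i, j, k). {p, translate p u i, translate p u j, translate p u k})"
  define D where "D = (\<lambda>s. grid N \<times> F s \<times> I s \<times> I s \<times> I s)"
  have finJ: "finite (J s)" and cardJ: "card (J s) = 2 * s + 1" for s unfolding J_def by auto
  have finF: "finite (F s)" for s unfolding F_def using finJ by auto
  have finD: "finite (D s)" for s unfolding D_def I_def using finJ finF finite_grid by auto
  have "aligned_subsets 4 (grid N) \<subseteq> \<Phi> ` (\<Union>s\<in>{1..N}. D s)"
  proof
    fix e assume "e \<in> aligned_subsets 4 (grid N)"
    then have e: "e \<subseteq> grid N" "card e = 4" "aligned_set e" unfolding aligned_subsets_def by auto
    obtain p e1 where p: "e = insert p e1" "p \<notin> e1" "card e1 = 3"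
      using e(2) card_Suc_eq[of e 3] by (auto simp: eval_nat_numeral)
    obtain q r s where qrs: "e1 = {q, r, s}" using p(3) unfolding card_3_iff by blast
    have pq: "p \<noteq> q" using p qrs by auto
    obtain x y z where xyz: "p = (x, y, z)" by (cases p)
    obtain a b c where abc: "(a, b, c) \<noteq> (0, 0, 0)"
      and line: "\<And>w. aligned p q w \<Longrightarrow> \<exists>k. w = translate p (a, b, c) k"
      using aligned_direction[OF pq] by (metis prod_cases3)
    define m where "m = nat (max \<bar>a\<bar> (max \<bar>b\<bar> \<bar>c\<bar>))"
    have m: "int m = max \<bar>a\<bar> (max \<bar>b\<bar> \<bar>c\<bar>)" unfolding m_def by simp
    have m1: "1 \<le> m"
    proof (rule ccontr)
      assume "\<not> 1 \<le> m"
      then have "a = 0" "b = 0" "c = 0" using m by auto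
      then show False using abc by simp
    qed
    have le_m: "a \<in> J m" "b \<in> J m" "c \<in> J m" unfolding J_def atLeastAtMost_iff using m by linarith+
    have "\<bar>a\<bar> = int m \<or> \<bar>b\<bar> = int m \<or> \<bar>c\<bar> = int m" using m by linarith
    then have "a \<in> {- int m, int m} \<or> b \<in> {- int m, int m} \<or> c \<in> {- int m, int m}"
      unfolding insert_iff empty_iff by linarith
    then have uF: "(a, b, c) \<in> F m" unfolding F_def using le_m by blast
    have pgrid: "(x, y, z) \<in> grid N" using e p xyz by auto
    have bound: "\<bar>k\<bar> * int m < int N" if w: "translate p (a, b, c) k \<in> e" for k
    proof -
      have "(x + k * a, y + k * b, z + k * c) \<in> grid N" using w e(1) unfolding xyz by auto
      then have "\<bar>k * a\<bar> < int N" "\<bar>k * b\<bar> < int N" "\<bar>k * c\<bar> < int N"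
        using pgrid unfolding grid_def by auto
      then show ?thesis unfolding m by (simp add: abs_mult max_def)
    qed
    have mult: "\<exists>k\<in>I m. w = translate p (a, b, c) k" if w: "w \<in> e" for w
    proof -
      have "aligned p q w" using e(3) w p qrs unfolding aligned_set_def by auto
      then obtain k where k: "w = translate p (a, b, c) k" using line by blast
      then have "int (nat \<bar>k\<bar> * m) < int N" using bound w by simp
      then have "nat \<bar>k\<bar> * m < N" by (simp only: of_nat_less_iff)
      then have "nat \<bar>k\<bar> \<le> N div m" using m1 by (simp add: less_eq_div_iff_mult_less_eq)
      then have "k \<in> I m" unfolding I_def J_def by auto
      then show ?thesis using k by blast
    qed
    obtain i where i: "i \<in> I m" "q = translate p (a, b, c) i" using mult[of q] p qrs by blast
    have mN: "m \<le> N"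
    proof -
      have "i \<noteq> 0" using pq i(2) unfolding xyz by auto
      then have "1 * int m \<le> \<bar>i\<bar> * int m" by (intro mult_right_mono) auto
      then show ?thesis using bound[of i] i(2) p qrs by auto
    qed
    obtain j where j: "j \<in> I m" "r = translate p (a, b, c) j" using mult[of r] p qrs by blast
    obtain k where k: "k \<in> I m" "s = translate p (a, b, c) k" using mult[of s] p qrs by blast
    have "e = \<Phi> (p, (a, b, c), i, j, k)" unfolding \<Phi>_def p(1) qrs using i(2) j(2) k(2) by simp
    moreover have "(p, (a, b, c), i, j, k) \<in> D m" unfolding D_def using pgrid uF i j k xyz by simp
    ultimately show "e \<in> \<Phi> ` (\<Union>s\<in>{1..N}. D s)" using m1 mN by fastforce
  qed
  then have "card (aligned_subsets 4 (grid N)) \<le> card (\<Phi> ` (\<Union>s\<in>{1..N}. D s))"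
    by (rule card_mono[rotated]) (use finD in auto)
  also have "\<dots> \<le> card (\<Union>s\<in>{1..N}. D s)" by (rule card_image_le) (use finD in auto)
  also have "\<dots> \<le> (\<Sum>s=1..N. card (D s))" by (rule card_UN_le) auto
  finally have "real (card (aligned_subsets 4 (grid N))) \<le> (\<Sum>s=1..N. real (card (D s)))"
    by (metis of_nat_le_iff of_nat_sum)
  also have "\<dots> \<le> (\<Sum>s=1..N. 1458 * real N ^ 6 * (1 / real s))"
  proof (rule sum_mono)
    fix s assume s: "s \<in> {1..N}"
    \<comment> \<open>The three pairs of opposite faces hold at most \<open>54 * s\<^sup>2\<close>
      vectors, and each multiplier takes at most \<open>3 * N / s\<close> values; 54 * 27 =
      1458.\<close>
    have "card (F s) \<le> card ({- int s, int s} \<times> J s \<times> J s) + card (J s \<times> {- int s, int s} \<times> J s) + card (J s \<times> J s \<times> {- int s, int s})"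
      unfolding F_def by (meson add_right_mono card_Un_le order_trans)
    also have "\<dots> \<le> 6 * (3 * s)\<^sup>2"
    proof -
      have "card {- int s, int s} \<le> 2" using card_insert_le_m1[of 2 "{int s}"] by simp
      moreover have "2 * s + 1 \<le> 3 * s" using s by simp
      ultimately have b: "card {- int s, int s} * ((2 * s + 1) * (2 * s + 1)) \<le> 2 * (3 * s * (3 * s))"
        by (intro mult_mono) auto
      define c where "c = card {- int s, int s}"
      have "c * ((2 * s + 1) * (2 * s + 1)) + (2 * s + 1) * (c * (2 * s + 1)) + (2 * s + 1) * ((2 * s + 1) * c) =
          3 * (c * ((2 * s + 1) * (2 * s + 1)))" by (simp add: algebra_simps)
      also have "\<dots> \<le> 3 * (2 * (3 * s * (3 * s)))" using b unfolding c_def by (rule mult_left_mono) simp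
      finally show ?thesis unfolding card_cartesian_product cardJ c_def[symmetric] power2_eq_square by simp
    qed
    finally have "card (F s) \<le> 54 * s\<^sup>2" by (simp add: power2_eq_square)
    then have F: "real (card (F s)) \<le> 54 * (real s)\<^sup>2"
      by (metis of_nat_le_iff of_nat_mult of_nat_numeral of_nat_power)
    have "1 \<le> N div s" using s by (simp add: Suc_leI div_greater_zero_iff)
    then have "card (I s) \<le> 3 * (N div s)" unfolding I_def cardJ by simp
    then have "real (card (I s)) \<le> 3 * real (N div s)" by linarith
    also have "\<dots> \<le> 3 * (real N / real s)" using of_nat_div_le_of_nat[of N s, where 'a = real] by simp
    finally have I: "real (card (I s)) \<le> 3 * real N / real s" by simp
    have "real (card (D s)) = real N ^ 3 * (real (card (F s)) * (real (card (I s)) * (real (card (I s)) * real (card (I s)))))"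
      unfolding D_def card_cartesian_product card_grid by simp
    also have "\<dots> \<le> real N ^ 3 * (54 * (real s)\<^sup>2 * (3 * real N / real s * (3 * real N / real s * (3 * real N / real s))))"
      using F I by (intro mult_mono mult_left_mono) auto
    also have "\<dots> = 1458 * real N ^ 6 * (1 / real s)"
    proof -
      have "real N ^ 6 = real N ^ 3 * real N ^ 3" by (simp flip: power_add)
      then show ?thesis using s by (simp add: field_simps power2_eq_square power3_eq_cube)
    qed
    finally show "real (card (D s)) \<le> 1458 * real N ^ 6 * (1 / real s)" .
  qed
  also have "\<dots> = 1458 * real N ^ 6 * (\<Sum>s=1..N. 1 / real s)" by (rule sum_distrib_left[symmetric])
  also have "\<dots> \<le> 1458 * real N ^ 6 * (1 + ln (real N))"
    using sum_inverse_le_ln[OF N] by (intro mult_left_mono) auto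
  finally show ?thesis .
qed

section \<open>Random sparsification\<close>

text \<open>Probability is done by counting: the functions form the sample space, and a given set of
  c points survives with probability \<open>1 / k^c\<close>.\<close>

lemma card_functions_vanishing:
  fixes V :: "'a set" and k :: nat
  assumes "finite V" "T \<subseteq> V" "1 \<le> k"
  shows "real (card {f \<in> V \<rightarrow>\<^sub>E {..<k}. T \<subseteq> {v \<in> V. f v = 0}}) = real k ^ card V / real k ^ card T"
proof -
  have "{f \<in> V \<rightarrow>\<^sub>E {..<k}. T \<subseteq> {v \<in> V. f v = 0}} = PiE V (\<lambda>v. if v \<in> T then {0} else {..<k})"
    using assms by (auto simp: PiE_def Pi_def extensional_def subset_iff split: if_splits)
  then have "card {f \<in> V \<rightarrow>\<^sub>E {..<k}. T \<subseteq> {v \<in> V. f v = 0}} = (\<Prod>v\<in>V. card (if v \<in> T then {0} else {..<k}))"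
    using assms by (simp add: card_PiE)
  also have "\<dots> = (\<Prod>v\<in>V - T. k)" using assms
    by (intro prod.mono_neutral_cong_right) auto
  also have "\<dots> = k ^ (card V - card T)" using assms by (simp add: card_Diff_subset finite_subset)
  finally have c: "card {f \<in> V \<rightarrow>\<^sub>E {..<k}. T \<subseteq> {v \<in> V. f v = 0}} = k ^ (card V - card T)" .
  show ?thesis unfolding c of_nat_power
    by (rule power_diff) (use assms in \<open>auto intro: card_mono\<close>)
qed

text \<open>Linearity of expectation, multiplied through by the size of the sample space.\<close>

lemma sum_contained_sets:
  fixes V :: "'a set" and k :: nat
  assumes V: "finite V" "1 \<le> k" and F: "\<And>T. T \<in> F \<Longrightarrow> T \<subseteq> V \<and> card T = c"
  shows "(\<Sum>f\<in>V \<rightarrow>\<^sub>E {..<k}. real (card {T \<in> F. T \<subseteq> {v \<in> V. f v = 0}})) =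
     real (card F) / real k ^ c * real k ^ card V"
proof -
  have finF: "finite F" by (rule finite_subset[of _ "Pow V"]) (use F V in auto)
  have "(\<Sum>f\<in>V \<rightarrow>\<^sub>E {..<k}. card {T \<in> F. T \<subseteq> {v \<in> V. f v = 0}}) =
      (\<Sum>T\<in>F. card {f \<in> V \<rightarrow>\<^sub>E {..<k}. T \<subseteq> {v \<in> V. f v = 0}})"
  proof (rule sum_multicount_gen)
    show "finite (V \<rightarrow>\<^sub>E {..<k})" using V by (intro finite_PiE) auto
  qed (use finF in auto)
  then have "(\<Sum>f\<in>V \<rightarrow>\<^sub>E {..<k}. real (card {T \<in> F. T \<subseteq> {v \<in> V. f v = 0}})) =
      (\<Sum>T\<in>F. real (card {f \<in> V \<rightarrow>\<^sub>E {..<k}. T \<subseteq> {v \<in> V. f v = 0}}))"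
    unfolding of_nat_sum[symmetric] by (rule arg_cong)
  also have "\<dots> = (\<Sum>T\<in>F. real k ^ card V / real k ^ c)"
    using F V by (intro sum.cong refl) (simp add: card_functions_vanishing)
  finally show ?thesis by simp
qed

text \<open>The subset is the zero set of a random function \<open>V \<rightarrow> {..<k}\<close>, i.e. each point is kept with
  probability \<open>1 / k\<close>, from which one point of every surviving member of \<open>Q\<close> is deleted. The factor
  \<open>card V\<close> makes a single surviving member of \<open>B\<close> outweigh all points.\<close>

lemma random_sparsification:
  fixes V :: "'a set" and k :: nat
  assumes V: "finite V" "1 \<le> k"
    and Q: "\<And>T. T \<in> Q \<Longrightarrow> T \<subseteq> V \<and> card T = 4" and B: "\<And>T. T \<in> B \<Longrightarrow> T \<subseteq> V \<and> card T = m"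
    and x: "0 < x" "x \<le> real (card V) / real k - real (card Q) / real k ^ 4 - real (card V) * (real (card B) / real k ^ m)"
  obtains P where "P \<subseteq> V" "\<And>T. T \<in> Q \<Longrightarrow> \<not> T \<subseteq> P" "\<And>T. T \<in> B \<Longrightarrow> \<not> T \<subseteq> P" "x \<le> real (card P)"
proof -
  let ?\<Omega> = "V \<rightarrow>\<^sub>E {..<k}"
  define Z where "Z = (\<lambda>f. {v \<in> V. f v = (0 :: nat)})"
  define g where "g = (\<lambda>f. real (card (Z f)) - real (card {T \<in> Q. T \<subseteq> Z f}) - real (card V) * real (card {T \<in> B. T \<subseteq> Z f}))"
  have finQ: "finite Q" by (rule finite_subset[of _ "Pow V"]) (use Q V in auto)
  have finB: "finite B" by (rule finite_subset[of _ "Pow V"]) (use B V in auto)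
  have fin\<Omega>: "finite ?\<Omega>" using V by (intro finite_PiE) auto
  have card\<Omega>: "real (card ?\<Omega>) = real k ^ card V" using V by (simp add: card_PiE)
  \<comment> \<open>Points are viewed as one-element sets so that the same expectation formula
    serves all three counts.\<close>
  have singles: "card (Z f) = card {T \<in> (\<lambda>v. {v}) ` V. T \<subseteq> Z f}" for f
  proof -
    have "{T \<in> (\<lambda>v. {v}) ` V. T \<subseteq> Z f} = (\<lambda>v. {v}) ` Z f" unfolding Z_def by auto
    then show ?thesis by (simp add: card_image)
  qed
  have "(\<Sum>f\<in>?\<Omega>. real (card (Z f))) = real (card ((\<lambda>v. {v}) ` V)) / real k ^ 1 * real k ^ card V"
    unfolding singles unfolding Z_def by (rule sum_contained_sets[OF V]) auto
  then have s1: "(\<Sum>f\<in>?\<Omega>. real (card (Z f))) = real (card V) / real k * real k ^ card V"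
    by (simp add: card_image)
  have s2: "(\<Sum>f\<in>?\<Omega>. real (card {T \<in> Q. T \<subseteq> Z f})) = real (card Q) / real k ^ 4 * real k ^ card V"
    unfolding Z_def by (rule sum_contained_sets[OF V Q])
  have s3: "(\<Sum>f\<in>?\<Omega>. real (card {T \<in> B. T \<subseteq> Z f})) = real (card B) / real k ^ m * real k ^ card V"
    unfolding Z_def by (rule sum_contained_sets[OF V B])
  have "(\<Sum>f\<in>?\<Omega>. g f) = (real (card V) / real k - real (card Q) / real k ^ 4 - real (card V) * (real (card B) / real k ^ m)) * real k ^ card V"
    unfolding g_def sum_subtractf sum_distrib_left[symmetric] s1 s2 s3 by (simp add: algebra_simps)
  moreover have "x * real k ^ card V \<le> (real (card V) / real k - real (card Q) / real k ^ 4 - real (card V) * (real (card B) / real k ^ m)) * real k ^ card V"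
    using x(2) by (rule mult_right_mono) simp
  ultimately have total: "(\<Sum>f\<in>?\<Omega>. x) \<le> (\<Sum>f\<in>?\<Omega>. g f)" using card\<Omega> by (simp add: mult.commute)
  have "\<exists>f\<in>?\<Omega>. x \<le> g f"
  proof (rule ccontr)
    assume "\<not> ?thesis"
    then have "(\<Sum>f\<in>?\<Omega>. g f) < (\<Sum>f\<in>?\<Omega>. x)"
      using V fin\<Omega> by (intro sum_strict_mono) (auto simp: PiE_eq_empty_iff not_le lessThan_empty_iff)
    then show False using total by linarith
  qed
  then obtain f where f: "x \<le> g f" by blast
  have finZ: "finite (Z f)" and ZV: "card (Z f) \<le> card V" unfolding Z_def using V by (auto intro: card_mono)
  have "{T \<in> B. T \<subseteq> Z f} = {}"
  proof (rule ccontr)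
    assume "{T \<in> B. T \<subseteq> Z f} \<noteq> {}"
    then have "1 \<le> card {T \<in> B. T \<subseteq> Z f}" using finB by (simp add: Suc_leI card_gt_0_iff)
    then have "real (card V) * 1 \<le> real (card V) * real (card {T \<in> B. T \<subseteq> Z f})"
      by (intro mult_left_mono) auto
    then show False using f x(1) ZV unfolding g_def by linarith
  qed
  then have noB: "\<not> T \<subseteq> Z f" if "T \<in> B" for T using that by blast
  define QZ where "QZ = {T \<in> Q. T \<subseteq> Z f}"
  have "\<exists>v. v \<in> T" if "T \<in> QZ" for T using Q[of T] that unfolding QZ_def
    by (metis card.empty equals0I mem_Collect_eq zero_neq_numeral)
  then obtain c where c: "\<And>T. T \<in> QZ \<Longrightarrow> c T \<in> T" by metis
  define P where "P = Z f - c ` QZ"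
  have "real (card (Z f)) \<le> real (card P) + real (card QZ)"
  proof -
    have "card (Z f) - card (c ` QZ) \<le> card P"
      unfolding P_def using finQ by (intro diff_card_le_card_Diff) (simp add: QZ_def)
    moreover have "card (c ` QZ) \<le> card QZ" using finQ by (intro card_image_le) (simp add: QZ_def)
    ultimately show ?thesis by linarith
  qed
  moreover have "0 \<le> real (card V) * real (card {T \<in> B. T \<subseteq> Z f})" by simp
  ultimately have "x \<le> real (card P)" using f unfolding g_def QZ_def by linarith
  moreover have "P \<subseteq> V" unfolding P_def Z_def by blast
  moreover have "\<not> T \<subseteq> P" if "T \<in> Q" for T
  proof
    assume T: "T \<subseteq> P"
    then have "T \<in> QZ" using that unfolding QZ_def P_def by blast
    then show False using c[of T] T unfolding P_def by blast
  qed
  moreover have "\<not> T \<subseteq> P" if "T \<in> B" for T using noB[OF that] unfolding P_def by blast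
  ultimately show ?thesis using that[of P] by blast
qed

section \<open>Bounding binomial coefficients\<close>

lemma power_self_le_exp_fact: "real m ^ m \<le> exp (real m) * fact m"
proof -
  have "real m ^ m / fact m \<le> exp (real m)"
  proof -
    \<comment> \<open>\<open>m^m / fact m\<close> is a single term of the exponential series at
      \<open>m\<close>.\<close>
    have "(\<Sum>n<Suc m. real m ^ n /\<^sub>R fact n) \<le> exp (real m)"
      unfolding exp_def by (rule sum_le_suminf) (use summable_exp_generic[of "real m"] in auto)
    then have "(\<Sum>n<Suc m. real m ^ n / fact n) \<le> exp (real m)" by (simp add: divide_inverse mult.commute)
    moreover have "0 \<le> (\<Sum>n<m. real m ^ n / fact n)" by (intro sum_nonneg) auto
    ultimately show ?thesis by simp
  qed
  then show ?thesis by (simp add: divide_le_eq)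
qed

lemma binomial_le_exp_power:
  assumes "0 < m"
  shows "real (n choose m) \<le> (exp 1 * real n / real m) ^ m"
proof -
  have "real (n choose m) * fact m \<le> real n ^ m"
    using binomial_fact_pow[of n m] by (metis of_nat_fact of_nat_le_iff of_nat_mult of_nat_power)
  then have "real (n choose m) * fact m * (real m ^ m) \<le> real n ^ m * (exp (real m) * fact m)"
    using power_self_le_exp_fact[of m] by (intro mult_mono) auto
  then have "real (n choose m) * real m ^ m \<le> real n ^ m * exp (real m)" by simp
  moreover have "exp (real m) = exp 1 ^ m" by (simp flip: exp_of_nat_mult)
  ultimately show ?thesis using assms by (simp add: power_mult_distrib power_divide field_simps)
qed

section \<open>From points to line arrangements\<close>

definition graph_line :: "real \<Rightarrow> real \<Rightarrow> (real^2) set" where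
  "graph_line a b = {x. x $ 2 = a * x $ 1 + b}"

lemma is_line_graph_line: "is_line (graph_line a b)"
proof -
  define u :: "real^2" where "u = vector [0, b]"
  define v :: "real^2" where "v = vector [1, a + b]"
  have uv: "u $ 1 = 0" "u $ 2 = b" "v $ 1 = 1" "v $ 2 = a + b" unfolding u_def v_def by simp_all
  have "graph_line a b = {u + t *\<^sub>R (v - u) | t. True}"
  proof (intro set_eqI iffI)
    fix x assume "x \<in> graph_line a b"
    then have "x = u + (x $ 1) *\<^sub>R (v - u)"
      unfolding graph_line_def by (simp add: vec_eq_iff forall_2 uv algebra_simps)
    then show "x \<in> {u + t *\<^sub>R (v - u) | t. True}" by blast
  next
    fix x assume "x \<in> {u + t *\<^sub>R (v - u) | t. True}"
    then obtain t where "x = u + t *\<^sub>R (v - u)" by blast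
    then have "x $ 1 = u $ 1 + t * (v $ 1 - u $ 1)" "x $ 2 = u $ 2 + t * (v $ 2 - u $ 2)" by simp_all
    then show "x \<in> graph_line a b" unfolding graph_line_def uv by simp
  qed
  moreover have "u \<noteq> v" using uv by (metis zero_neq_one)
  ultimately show ?thesis unfolding is_line_def by blast
qed

lemma graph_line_eq_iff: "graph_line a b = graph_line a' b' \<longleftrightarrow> a = a' \<and> b = b'"
proof
  assume eq: "graph_line a b = graph_line a' b'"
  have "(vector [0, b] :: real^2) \<in> graph_line a b" "(vector [1, a + b] :: real^2) \<in> graph_line a b"
    unfolding graph_line_def by simp_all
  then show "a = a' \<and> b = b'" unfolding eq unfolding graph_line_def by simp
qed simp

lemma graph_lines_meet:
  assumes "a \<noteq> a'"
  shows "graph_line a b \<inter> graph_line a' b' \<noteq> {}"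
proof -
  define X where "X = (b' - b) / (a - a')"
  have "a * X + b = a' * X + b'" unfolding X_def using assms by (simp add: field_simps)
  then have "(vector [X, a * X + b] :: real^2) \<in> graph_line a b \<inter> graph_line a' b'"
    unfolding graph_line_def by simp
  then show ?thesis by blast
qed

lemma finite_graph_lines_Int:
  assumes "a \<noteq> a'"
  shows "finite (graph_line a b \<inter> graph_line a' b')"
proof -
  have "x = vector [(b' - b) / (a - a'), a * ((b' - b) / (a - a')) + b]"
    if "x \<in> graph_line a b \<inter> graph_line a' b'" for x
  proof -
    have x: "x $ 2 = a * x $ 1 + b" "x $ 2 = a' * x $ 1 + b'" using that unfolding graph_line_def by auto
    then have "x $ 1 * (a - a') = b' - b" by (simp add: algebra_simps)
    then have "x $ 1 = (b' - b) / (a - a')" using assms by (simp add: eq_divide_eq)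
    then show ?thesis using x by (simp add: vec_eq_iff forall_2)
  qed
  then have "graph_line a b \<inter> graph_line a' b' \<subseteq> {vector [(b' - b) / (a - a'), a * ((b' - b) / (a - a')) + b]}"
    by blast
  then show ?thesis using finite_subset by blast
qed

fun collinear_points :: "real \<times> real \<Rightarrow> real \<times> real \<Rightarrow> real \<times> real \<Rightarrow> bool" where
  "collinear_points (a, b) (a', b') (a'', b'') \<longleftrightarrow> (b - b') * (a - a'') = (b - b'') * (a - a')"

text \<open>The dual line of \<open>(a, b)\<close>, perturbed so that the lines dual to collinear points become tangents
  of the translate of one parabola: three of them are never concurrent.\<close>

definition dual_line :: "real \<Rightarrow> real \<times> real \<Rightarrow> (real^2) set" where
  "dual_line \<epsilon> p = graph_line (fst p) (snd p + \<epsilon> * (fst p)\<^sup>2)"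

text \<open>Eliminating the common point leaves the collinearity determinant on the left and
  \<open>\<epsilon>\<close> times a Vandermonde product on the right. For distinct slopes
  concurrency thus forces one particular \<open>\<epsilon>\<close>, which is 0 if the points are
  collinear.\<close>

lemma concurrent_dual_lines:
  assumes x: "x \<in> dual_line \<epsilon> (a, b) \<inter> dual_line \<epsilon> (a', b') \<inter> dual_line \<epsilon> (a'', b'')"
  shows "(b - b') * (a - a'') - (b - b'') * (a - a') = \<epsilon> * ((a'' - a') * (a - a') * (a - a''))"
proof -
  have e: "x $ 2 = a * x $ 1 + b + \<epsilon> * a\<^sup>2" "x $ 2 = a' * x $ 1 + b' + \<epsilon> * a'\<^sup>2" "x $ 2 = a'' * x $ 1 + b'' + \<epsilon> * a''\<^sup>2"
    using x unfolding dual_line_def graph_line_def by auto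
  have 1: "b - b' = - (a - a') * (x $ 1 + \<epsilon> * (a + a'))"
    using e by (simp add: algebra_simps power2_eq_square)
  have 2: "b - b'' = - (a - a'') * (x $ 1 + \<epsilon> * (a + a''))"
    using e by (simp add: algebra_simps power2_eq_square)
  show ?thesis unfolding 1 2 by (simp add: algebra_simps)
qed

text \<open>In coordinates centred at the common point of the unperturbed lines, the three perturbed lines
  with slopes \<open>a < b < c\<close> bound the triangle \<open>T\<close> below, which has diameter \<open>O(\<epsilon>)\<close>.\<close>

lemma triangle_cell:
  fixes P :: "(real \<times> real) set"
  assumes \<epsilon>: "0 < \<epsilon>" and P: "p \<in> P" "q \<in> P" "r \<in> P" and less: "fst p < fst q" "fst q < fst r"
    and xc: "snd p = yc - fst p * xc" "snd q = yc - fst q * xc" "snd r = yc - fst r * xc"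
    and B: "\<And>s. s \<in> P \<Longrightarrow> \<bar>fst s\<bar> \<le> B"
    and small: "\<And>s. s \<in> P \<Longrightarrow> s \<notin> {p, q, r} \<Longrightarrow> 6 * B\<^sup>2 * \<epsilon> < \<bar>yc - fst s * xc - snd s\<bar>"
    and inj: "inj_on fst P"
  shows "\<exists>C\<in>cells (dual_line \<epsilon> ` P). cell_lines (dual_line \<epsilon> ` P) C \<subseteq> dual_line \<epsilon> ` {p, q, r}"
proof -
  define a b c where "a = fst p" and "b = fst q" and "c = fst r"
  note abc = a_def b_def c_def
  have ab: "a < b" and bc: "b < c" using less unfolding abc by auto
  define h where "h = (\<lambda>a (x :: real^2). (x $ 2 - yc) - a * (x $ 1 - xc) - \<epsilon> * a\<^sup>2)"
  have line: "dual_line \<epsilon> p = {x. h a x = 0}" "dual_line \<epsilon> q = {x. h b x = 0}" "dual_line \<epsilon> r = {x. h c x = 0}"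
    unfolding dual_line_def graph_line_def h_def abc xc by (auto simp: algebra_simps)
  have cont: "continuous_on UNIV (h a)" for a unfolding h_def by (intro continuous_intros)
  define T where "T = {x. h a x < 0} \<inter> {x. 0 < h b x} \<inter> {x. h c x < 0}"
  define K where "K = {x. h a x \<le> 0} \<inter> {x. 0 \<le> h b x} \<inter> {x. h c x \<le> 0}"
  have "open T" unfolding T_def
    by (intro open_Int open_Collect_less cont continuous_on_const)
  have "closed K" unfolding K_def
    by (intro closed_Int closed_Collect_le cont continuous_on_const)
  have h_affine: "h a x = inner (vector [- a, 1]) x - (yc - a * xc + \<epsilon> * a\<^sup>2)" for a x
    unfolding h_def by (simp add: inner_vec_def sum_2 algebra_simps)
  have "convex T" unfolding T_def h_affine less_diff_eq diff_less_eq
    by (intro convex_Int; (simp add: convex_halfspace_lt convex_halfspace_gt))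
  then have "connected T" by (rule convex_connected)
  have frontier: "frontier T \<subseteq> dual_line \<epsilon> p \<union> dual_line \<epsilon> q \<union> dual_line \<epsilon> r"
  proof -
    have "closure T \<subseteq> K" using \<open>closed K\<close> by (intro closure_minimal) (auto simp: T_def K_def)
    then have "frontier T \<subseteq> K - T" unfolding frontier_def using \<open>open T\<close> by (auto simp: interior_open)
    also have "\<dots> \<subseteq> dual_line \<epsilon> p \<union> dual_line \<epsilon> q \<union> dual_line \<epsilon> r" unfolding K_def T_def line by auto
    finally show ?thesis .
  qed
  have nonempty: "T \<noteq> {}"
  proof -
    \<comment> \<open>The centroid: relative to the centre, the lines of slopes \<open>a\<close> and
      \<open>b\<close> meet at
      \<open>(- \<epsilon> * (a + b), - \<epsilon> * a * b)\<close>.\<close>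
    define x :: "real^2" where "x = vector [xc - 2 * \<epsilon> * (a + b + c) / 3, yc - \<epsilon> * (a * b + a * c + b * c) / 3]"
    have "h a x = - \<epsilon> * ((b - a) * (c - a)) / 3" "h b x = \<epsilon> * ((b - a) * (c - b)) / 3" "h c x = - \<epsilon> * ((c - a) * (c - b)) / 3"
      unfolding h_def x_def by (simp_all add: field_simps power2_eq_square)
    moreover have "0 < \<epsilon> * ((b - a) * (c - a))" "0 < \<epsilon> * ((b - a) * (c - b))" "0 < \<epsilon> * ((c - a) * (c - b))"
      using \<epsilon> ab bc by simp_all
    ultimately have "h a x < 0" "0 < h b x" "h c x < 0" by simp_all
    then have "x \<in> T" unfolding T_def by simp
    then show ?thesis by blast
  qed
  have avoid: "T \<inter> dual_line \<epsilon> s = {}" if s: "s \<in> P" for s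
  proof (cases "s \<in> {p, q, r}")
    case True
    then show ?thesis unfolding T_def using line by auto
  next
    case False
    show ?thesis
    proof (rule ccontr)
      assume "T \<inter> dual_line \<epsilon> s \<noteq> {}"
      then obtain x where x: "x \<in> T" "x \<in> dual_line \<epsilon> s" by blast
      define u w d where "u = x $ 1 - xc" and "w = x $ 2 - yc" and "d = fst s"
      have Bs: "\<bar>a\<bar> \<le> B" "\<bar>b\<bar> \<le> B" "\<bar>c\<bar> \<le> B" "\<bar>d\<bar> \<le> B" unfolding abc d_def using B P s by auto
      then have B0: "0 \<le> B" by linarith
      have sq: "\<bar>\<epsilon> * t\<^sup>2\<bar> \<le> B\<^sup>2 * \<epsilon>" if "\<bar>t\<bar> \<le> B" for t
        using that \<epsilon> B0 by (simp add: abs_mult mult.commute abs_le_square_iff[symmetric])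
      have ha: "w - a * u - \<epsilon> * a\<^sup>2 < 0" and hb: "0 < w - b * u - \<epsilon> * b\<^sup>2" and hc: "w - c * u - \<epsilon> * c\<^sup>2 < 0"
        using x(1) unfolding T_def h_def u_def w_def by auto
      have "(b - a) * (u + \<epsilon> * (a + b)) < 0" using ha hb by (simp add: algebra_simps power2_eq_square)
      then have "u + \<epsilon> * (a + b) < 0" using ab by (simp add: mult_less_0_iff)
      moreover have "0 < (c - b) * (u + \<epsilon> * (b + c))" using hc hb by (simp add: algebra_simps power2_eq_square)
      then have "0 < u + \<epsilon> * (b + c)" using bc by (simp add: zero_less_mult_iff)
      moreover have "\<epsilon> * \<bar>a + b\<bar> \<le> \<epsilon> * (2 * B)" "\<epsilon> * \<bar>b + c\<bar> \<le> \<epsilon> * (2 * B)"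
        using Bs \<epsilon> by (auto intro!: mult_left_mono)
      then have "\<bar>\<epsilon> * (a + b)\<bar> \<le> 2 * B * \<epsilon>" "\<bar>\<epsilon> * (b + c)\<bar> \<le> 2 * B * \<epsilon>"
        using \<epsilon> by (simp_all add: abs_mult ac_simps)
      ultimately have u: "\<bar>u\<bar> \<le> 2 * B * \<epsilon>" by linarith
      have mult: "\<bar>t * u\<bar> \<le> 2 * B\<^sup>2 * \<epsilon>" if "\<bar>t\<bar> \<le> B" for t
        using mult_mono[OF that u B0] by (simp add: abs_mult power2_eq_square ac_simps)
      \<comment> \<open>Origin of the constant 6: in units of \<open>B\<^sup>2 * \<epsilon>\<close>,
        the terms \<open>w\<close>, \<open>d * u\<close> and \<open>\<epsilon> * d\<^sup>2\<close>
        contribute at most 3, 2 and 1. A further line meeting \<open>T\<close> would pass too close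
        to the centre.\<close>
      have "\<bar>w\<bar> \<le> 3 * B\<^sup>2 * \<epsilon>"
        using ha hb mult[OF Bs(1)] mult[OF Bs(2)] sq[OF Bs(1)] sq[OF Bs(2)] by linarith
      moreover have "yc - fst s * xc - snd s = - (w - d * u - \<epsilon> * d\<^sup>2)"
        using x(2) unfolding dual_line_def graph_line_def u_def w_def d_def by (simp add: algebra_simps)
      ultimately have "\<bar>yc - fst s * xc - snd s\<bar> \<le> 6 * B\<^sup>2 * \<epsilon>"
        using mult[OF Bs(4)] sq[OF Bs(4)] by linarith
      then show False using small[OF s False] by linarith
    qed
  qed
  have "T \<in> cells (dual_line \<epsilon> ` P)"
    unfolding cells_def in_components_maximal
  proof (intro conjI allI impI)
    show "T \<subseteq> UNIV - \<Union> (dual_line \<epsilon> ` P)" using avoid by blast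
    fix D assume D: "D \<noteq> {} \<and> T \<subseteq> D \<and> D \<subseteq> UNIV - \<Union> (dual_line \<epsilon> ` P) \<and> connected D"
    \<comment> \<open>A connected set that meets \<open>T\<close> and leaves it has to cross the
      frontier, which lies on lines of the arrangement.\<close>
    have "D \<inter> frontier T = {}" using D frontier P by blast
    then have "D - T = {}" using connected_Int_frontier[of D T] D nonempty by blast
    then show "D = T" using D by blast
  qed (use nonempty \<open>connected T\<close> in auto)
  moreover have "cell_lines (dual_line \<epsilon> ` P) T \<subseteq> dual_line \<epsilon> ` {p, q, r}"
  proof
    fix L assume L: "L \<in> cell_lines (dual_line \<epsilon> ` P) T"
    then obtain s where s: "s \<in> P" "L = dual_line \<epsilon> s" unfolding cell_lines_def by blast
    obtain y z where yz: "y \<noteq> z" "closed_segment y z \<subseteq> L \<inter> frontier T" using L unfolding cell_lines_def by blast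
    show "L \<in> dual_line \<epsilon> ` {p, q, r}"
    proof (rule ccontr)
      assume "L \<notin> dual_line \<epsilon> ` {p, q, r}"
      then have "s \<notin> {p, q, r}" using s by blast
      \<comment> \<open>A fourth line has a slope of its own and meets each of the three lines only
        once, so it cannot contain a segment of the frontier.\<close>
      then have "fst s \<noteq> fst p" "fst s \<noteq> fst q" "fst s \<noteq> fst r"
        using inj s P unfolding inj_on_def by blast+
      then have "finite (L \<inter> dual_line \<epsilon> p \<union> L \<inter> dual_line \<epsilon> q \<union> L \<inter> dual_line \<epsilon> r)"
        unfolding s dual_line_def using finite_graph_lines_Int by blast
      moreover have "closed_segment y z \<subseteq> L \<inter> dual_line \<epsilon> p \<union> L \<inter> dual_line \<epsilon> q \<union> L \<inter> dual_line \<epsilon> r"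
        using yz(2) frontier by blast
      ultimately have "finite (closed_segment y z)" using finite_subset by blast
      then show False using yz(1) by (simp add: finite_closed_segment)
    qed
  qed
  ultimately show ?thesis by blast
qed

lemma sorted_triple:
  fixes f :: "'a \<Rightarrow> real"
  assumes "card e = 3" "inj_on f e"
  obtains p q r where "e = {p, q, r}" "f p < f q" "f q < f r"
proof -
  obtain x y z where xyz: "e = {x, y, z}" "x \<noteq> y" "x \<noteq> z" "y \<noteq> z"
    using assms(1) unfolding card_3_iff by blast
  have "f x \<noteq> f y" "f x \<noteq> f z" "f y \<noteq> f z" using assms(2) xyz unfolding inj_on_def by blast+
  then consider "f x < f y" "f y < f z" | "f x < f z" "f z < f y" | "f y < f x" "f x < f z"
    | "f y < f z" "f z < f x" | "f z < f x" "f x < f y" | "f z < f y" "f y < f x" by linarith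
  then show ?thesis by cases (use that xyz(1) in \<open>auto simp: insert_commute\<close>)
qed

text \<open>Only finitely many conditions are imposed on \<open>\<epsilon>\<close>: one forbidden
  value per triple, for simplicity of the arrangement, and upper bounds that keep other lines away
  from the small triangles. By \<open>no4\<close>, no other unperturbed line passes through a triple
  point, so these bounds apply to every other line.\<close>

theorem arrangement_of_points:
  fixes P :: "(real \<times> real) set"
  assumes fin: "finite P" and inj: "inj_on fst P"
    and no4: "\<And>p q r s. \<lbrakk>p \<in> P; q \<in> P; r \<in> P; s \<in> P; distinct [p, q, r, s]; collinear_points p q r\<rbrakk>
         \<Longrightarrow> \<not> collinear_points p q s"
  obtains L where "inj_on L P" "simple_arrangement (L ` P)"
    "\<And>e. \<lbrakk>e \<subseteq> P; card e = 3; \<forall>p\<in>e. \<forall>q\<in>e. \<forall>r\<in>e. collinear_points p q r\<rbrakk>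
       \<Longrightarrow> \<exists>C\<in>cells (L ` P). cell_lines (L ` P) C \<subseteq> L ` e"
proof -
  obtain B where B: "\<And>s. s \<in> P \<Longrightarrow> \<bar>fst s\<bar> \<le> B"
    using finite_imageI[OF fin, of "\<lambda>s. \<bar>fst s\<bar>"] by (meson bdd_above_finite bdd_above_def imageI)
  \<comment> \<open>\<open>X p q\<close> is the abscissa where the unperturbed lines of
    \<open>p\<close> and \<open>q\<close> cross, \<open>h0 p q s\<close> the height of that crossing
    above the line of \<open>s\<close>, and \<open>bad p q r\<close> the only
    \<open>\<epsilon>\<close> at which three perturbed lines of distinct slopes can be
    concurrent.\<close>
  define X where "X = (\<lambda>p q :: real \<times> real. - (snd p - snd q) / (fst p - fst q))"
  define h0 where "h0 = (\<lambda>p q s :: real \<times> real. (fst p * X p q + snd p) - fst s * X p q - snd s)"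
  define bad where "bad = (\<lambda>p q r :: real \<times> real. ((snd p - snd q) * (fst p - fst r) - (snd p - snd r) * (fst p - fst q)) /
         ((fst r - fst q) * (fst p - fst q) * (fst p - fst r)))"
  have neq: "\<forall>\<^sub>F \<epsilon> in at_right 0. \<epsilon> \<noteq> (c :: real)" for c
  proof (cases "0 < c")
    case True
    then show ?thesis unfolding eventually_at_right_field by (intro exI[of _ c]) auto
  next
    case False
    then show ?thesis unfolding eventually_at_right_field by (intro exI[of _ 1]) auto
  qed
  have lt: "\<forall>\<^sub>F \<epsilon> in at_right 0. d \<noteq> 0 \<longrightarrow> 6 * B\<^sup>2 * \<epsilon> < \<bar>d\<bar>" for d :: real
  proof (cases "d = 0")
    case False
    have "((\<lambda>\<epsilon>. 6 * B\<^sup>2 * \<epsilon>) \<longlongrightarrow> 6 * B\<^sup>2 * 0) (at_right 0)" by (intro tendsto_intros)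
    then have "\<forall>\<^sub>F \<epsilon> in at_right 0. 6 * B\<^sup>2 * \<epsilon> < \<bar>d\<bar>" using False by (intro order_tendstoD(2)) auto
    then show ?thesis by eventually_elim simp
  qed simp
  have "\<forall>\<^sub>F \<epsilon> in at_right 0. 0 < \<epsilon> \<and> (\<forall>p\<in>P. \<forall>q\<in>P. \<forall>r\<in>P. \<epsilon> \<noteq> bad p q r) \<and>
      (\<forall>p\<in>P. \<forall>q\<in>P. \<forall>s\<in>P. h0 p q s \<noteq> 0 \<longrightarrow> 6 * B\<^sup>2 * \<epsilon> < \<bar>h0 p q s\<bar>)"
    by (intro eventually_conj eventually_ball_finite ballI fin neq lt eventually_at_right_less)
  from eventually_happens'[OF trivial_limit_at_right_real this]
  obtain \<epsilon> where \<epsilon>: "0 < \<epsilon>" "\<And>p q r. p \<in> P \<Longrightarrow> q \<in> P \<Longrightarrow> r \<in> P \<Longrightarrow> \<epsilon> \<noteq> bad p q r"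
    "\<And>p q s. p \<in> P \<Longrightarrow> q \<in> P \<Longrightarrow> s \<in> P \<Longrightarrow> h0 p q s \<noteq> 0 \<Longrightarrow> 6 * B\<^sup>2 * \<epsilon> < \<bar>h0 p q s\<bar>"
    by blast
  show ?thesis
  proof (rule that[of "dual_line \<epsilon>"])
    have fst_neq: "fst p \<noteq> fst q" if "p \<in> P" "q \<in> P" "p \<noteq> q" for p q
      using that inj unfolding inj_on_def by blast
    show injL: "inj_on (dual_line \<epsilon>) P"
      using fst_neq unfolding inj_on_def dual_line_def graph_line_eq_iff by blast
    show "simple_arrangement (dual_line \<epsilon> ` P)"
      unfolding simple_arrangement_def
    proof (intro conjI ballI impI)
      show "finite (dual_line \<epsilon> ` P)" using fin by simp
      show "is_line L" if "L \<in> dual_line \<epsilon> ` P" for L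
        using that is_line_graph_line unfolding dual_line_def by blast
      show "L1 \<inter> L2 \<noteq> {}" if L: "L1 \<in> dual_line \<epsilon> ` P" "L2 \<in> dual_line \<epsilon> ` P" "L1 \<noteq> L2" for L1 L2
      proof -
        obtain p q where "p \<in> P" "q \<in> P" "L1 = dual_line \<epsilon> p" "L2 = dual_line \<epsilon> q" using L by blast
        then show ?thesis using L(3) graph_lines_meet fst_neq unfolding dual_line_def by metis
      qed
      fix L1 L2 L3 assume L: "L1 \<in> dual_line \<epsilon> ` P" "L2 \<in> dual_line \<epsilon> ` P" "L3 \<in> dual_line \<epsilon> ` P"
        and neq: "L1 \<noteq> L2 \<and> L1 \<noteq> L3 \<and> L2 \<noteq> L3"
      obtain p q r where pqr: "p \<in> P" "q \<in> P" "r \<in> P" "L1 = dual_line \<epsilon> p" "L2 = dual_line \<epsilon> q" "L3 = dual_line \<epsilon> r"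
        using L by blast
      have W: "(fst r - fst q) * (fst p - fst q) * (fst p - fst r) \<noteq> 0"
      proof -
        have "r \<noteq> q" "p \<noteq> q" "p \<noteq> r" using neq unfolding pqr(4-6) by blast+
        then show ?thesis using fst_neq pqr(1-3) by simp
      qed
      show "L1 \<inter> L2 \<inter> L3 = {}"
      proof (rule ccontr)
        assume "L1 \<inter> L2 \<inter> L3 \<noteq> {}"
        then obtain x where "x \<in> dual_line \<epsilon> (fst p, snd p) \<inter> dual_line \<epsilon> (fst q, snd q) \<inter> dual_line \<epsilon> (fst r, snd r)"
          unfolding pqr by auto
        from concurrent_dual_lines[OF this] have "\<epsilon> = bad p q r"
          unfolding bad_def using W by (simp add: eq_divide_eq)
        then show False using \<epsilon>(2) pqr by blast
      qed
    qed
    fix e assume e: "e \<subseteq> P" "card e = 3" "\<forall>p\<in>e. \<forall>q\<in>e. \<forall>r\<in>e. collinear_points p q r"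
    obtain p q r where pqr: "e = {p, q, r}" "fst p < fst q" "fst q < fst r"
      using sorted_triple[OF e(2)] inj e(1) by (metis inj_on_subset)
    have P: "p \<in> P" "q \<in> P" "r \<in> P" using e pqr by auto
    have col_h0: "collinear_points p q s \<longleftrightarrow> h0 p q s = 0" for s
    proof -
      have "(fst p - fst q) * h0 p q s = (snd p - snd s) * (fst p - fst q) - (snd p - snd q) * (fst p - fst s)"
      proof -
        have X: "(fst p - fst q) * X p q = - (snd p - snd q)" unfolding X_def using pqr(2) by simp
        have "(fst p - fst q) * h0 p q s =
            (fst p - fst s) * ((fst p - fst q) * X p q) + (fst p - fst q) * (snd p - snd s)"
          unfolding h0_def by (simp add: algebra_simps)
        then show ?thesis unfolding X by (simp add: algebra_simps)
      qed
      moreover have "collinear_points p q s \<longleftrightarrow> (snd p - snd q) * (fst p - fst s) = (snd p - snd s) * (fst p - fst q)"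
        by (cases p; cases q; cases s) simp
      ultimately show ?thesis using pqr(2) by (metis diff_0_right eq_iff_diff_eq_0 less_irrefl mult_eq_0_iff)
    qed
    have h0_zero: "h0 p q s = 0" if "s \<in> e" for s using that e(3) pqr(1) col_h0 by blast
    show "\<exists>C\<in>cells (dual_line \<epsilon> ` P). cell_lines (dual_line \<epsilon> ` P) C \<subseteq> dual_line \<epsilon> ` e"
      unfolding pqr(1)
    proof (rule triangle_cell[where xc = "X p q" and yc = "fst p * X p q + snd p", OF \<epsilon>(1) P pqr(2,3) _ _ _ B _ inj])
      show "snd p = fst p * X p q + snd p - fst p * X p q" by simp
      show "snd q = fst p * X p q + snd p - fst q * X p q" "snd r = fst p * X p q + snd p - fst r * X p q"
        using h0_zero[of q] h0_zero[of r] pqr(1) unfolding h0_def by auto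
      fix s assume s: "s \<in> P" "s \<notin> {p, q, r}"
      have "distinct [p, q, r, s]" using s pqr by auto
      then have "\<not> collinear_points p q s" using no4[of p q r s] P s e(3) pqr(1) by blast
      then have "6 * B\<^sup>2 * \<epsilon> < \<bar>h0 p q s\<bar>" using \<epsilon>(3) P s col_h0 by blast
      then show "6 * B\<^sup>2 * \<epsilon> < \<bar>fst p * X p q + snd p - fst s * X p q - snd s\<bar>" unfolding h0_def .
    qed
  qed
qed

section \<open>Unavoidable cells\<close>

text \<open>Keeping points at rate \<open>1 / k\<close> leaves \<open>q^6 / l\<close> of them on
  average. The quadruples cost at most a quarter of this, and so do the \<open>m\<close>-subsets of
  containers, even weighted by the number of all points. The parameter \<open>l\<close> absorbs
  logarithms and constants.\<close>

lemma grid_point_set: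
  fixes q l :: nat
  assumes q: "9 \<le> q" and l: "175000 \<le> l" "ln (real q) \<le> real l"
  obtains P where "P \<subseteq> grid (q ^ 3)" "aligned_subsets 4 P = {}" "real q ^ 6 / (2 * real l) \<le> real (card P)"
    "\<And>S. S \<subseteq> P \<Longrightarrow> q ^ 5 * l ^ 3 \<le> card S \<Longrightarrow> aligned_subsets 3 S \<noteq> {}"
proof -
  let ?V = "grid (q ^ 3)"
  define k m where "k = q ^ 3 * l" and "m = q ^ 5 * l ^ 3"
  define Q where "Q = aligned_subsets 4 ?V"
  have q0: "0 < real q" and l0: "0 < real l" and lnq: "0 \<le> ln (real q)" using q l by auto
  have k1: "1 \<le> k" and m0: "0 < m" unfolding k_def m_def using q l by auto
  have k: "real k = real q ^ 3 * real l" and m: "real m = real q ^ 5 * real l ^ 3" unfolding k_def m_def by auto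
  have cardV: "real (card ?V) = real q ^ 9" by (simp add: card_grid flip: power_mult)
  obtain \<C> where \<C>: "finite \<C>" "real (card \<C>) \<le> exp (175000 * real q ^ 5 * (ln (real q))\<^sup>2)"
    "\<And>C. C \<in> \<C> \<Longrightarrow> C \<subseteq> ?V" "\<And>C. C \<in> \<C> \<Longrightarrow> real (card C) \<le> 12 * real q ^ 8"
    "\<And>I. I \<subseteq> ?V \<Longrightarrow> independent_in (aligned_subsets 3 ?V) I \<Longrightarrow> \<exists>C\<in>\<C>. I \<subseteq> C"
    using grid_containers[OF q] unfolding has_containers_def by meson
  \<comment> \<open>A subset of \<open>P\<close> with \<open>m\<close> points and no aligned triple
    would lie in a container and hence belong to \<open>B\<close>.\<close>
  define B where "B = (\<Union>C\<in>\<C>. {T. T \<subseteq> C \<and> card T = m})"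
  have finC: "finite C" if "C \<in> \<C>" for C using \<C>(3)[OF that] finite_grid finite_subset by blast
  have VK: "real (card ?V) / real k = real q ^ 6 / real l"
  proof -
    have "real q ^ 9 = real q ^ 6 * real q ^ 3" by (simp flip: power_add)
    then show ?thesis unfolding cardV k using q0 l0 by (simp add: field_simps)
  qed
  have Qk: "real (card Q) / real k ^ 4 \<le> real q ^ 6 / (4 * real l)"
  proof -
    have "1 \<le> q ^ 3" using q by simp
    then have "real (card Q) \<le> 1458 * real (q ^ 3) ^ 6 * (1 + ln (real (q ^ 3)))"
      unfolding Q_def by (rule card_aligned_quadruples_le)
    also have "\<dots> \<le> 1458 * real (q ^ 3) ^ 6 * (4 * real l)"
    proof (rule mult_left_mono)
      have "ln (real (q ^ 3)) = 3 * ln (real q)" using q0 by (simp add: ln_realpow)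
      then show "1 + ln (real (q ^ 3)) \<le> 4 * real l" using l by linarith
    qed simp
    also have "real (q ^ 3) ^ 6 = real q ^ 6 * real q ^ 12" by (simp flip: power_mult power_add)
    finally have "real (card Q) / real k ^ 4 \<le> 1458 * (real q ^ 6 * real q ^ 12) * (4 * real l) / real k ^ 4"
      by (rule divide_right_mono) simp
    also have k4: "real k ^ 4 = real q ^ 12 * real l ^ 4" unfolding k by (simp add: power_mult_distrib flip: power_mult)
    also have "1458 * (real q ^ 6 * real q ^ 12) * (4 * real l) / (real q ^ 12 * real l ^ 4) = real q ^ 6 / real l * (5832 / real l ^ 2)"
      using q0 l0 by (simp add: field_simps power2_eq_square power4_eq_xxxx)
    also have "\<dots> \<le> real q ^ 6 / real l * (1 / 4)"
    proof (rule mult_left_mono)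
      have "(175000 :: real)\<^sup>2 \<le> real l ^ 2" using l by (intro power_mono) auto
      then show "5832 / real l ^ 2 \<le> 1 / 4" using l0 by (simp add: divide_le_eq)
    qed simp
    finally show ?thesis unfolding k4 by simp
  qed
  have Bk: "real (card B) / real k ^ m \<le> exp (- real m)"
  proof -
    have choose: "real (card {T. T \<subseteq> C \<and> card T = m}) \<le> (12 * exp 1 * real q ^ 8 / real m) ^ m" if "C \<in> \<C>" for C
    proof -
      have "card {T. T \<subseteq> C \<and> card T = m} = card C choose m" by (rule n_subsets[OF finC[OF that]])
      then have "real (card {T. T \<subseteq> C \<and> card T = m}) \<le> (exp 1 * real (card C) / real m) ^ m"
        using binomial_le_exp_power[OF m0] by simp
      also have "\<dots> \<le> (exp 1 * (12 * real q ^ 8) / real m) ^ m"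
        using \<C>(4)[OF that] by (intro power_mono divide_right_mono mult_left_mono) auto
      finally show ?thesis by (simp add: ac_simps)
    qed
    have "card B \<le> (\<Sum>C\<in>\<C>. card {T. T \<subseteq> C \<and> card T = m})" unfolding B_def by (rule card_UN_le[OF \<C>(1)])
    then have "real (card B) \<le> (\<Sum>C\<in>\<C>. real (card {T. T \<subseteq> C \<and> card T = m}))"
      unfolding of_nat_sum[symmetric] by (simp only: of_nat_le_iff)
    also have "\<dots> \<le> (\<Sum>C\<in>\<C>. (12 * exp 1 * real q ^ 8 / real m) ^ m)" by (rule sum_mono[OF choose])
    also have "\<dots> = real (card \<C>) * (12 * exp 1 * real q ^ 8 / real m) ^ m" by simp
    finally have "real (card B) / real k ^ m \<le> real (card \<C>) * (12 * exp 1 * real q ^ 8 / real m) ^ m / real k ^ m"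
      by (rule divide_right_mono) simp
    also have "\<dots> = real (card \<C>) * (12 * exp 1 * real q ^ 8 / (real m * real k)) ^ m"
      by (simp add: power_divide power_mult_distrib)
    also have "12 * exp 1 * real q ^ 8 / (real m * real k) = 12 * exp 1 / real l ^ 4"
    proof -
      have "real q ^ 8 = real q ^ 5 * real q ^ 3" by (simp flip: power_add)
      then show ?thesis unfolding m k using q0 l0 by (simp add: field_simps power3_eq_cube power4_eq_xxxx)
    qed
    \<comment> \<open>In \<open>m = q^5 * l^3\<close>, one factor \<open>l\<close> covers the
      constant 175000 of the container count and the other two cover
      \<open>(ln q)\<^sup>2\<close>.\<close>
    also have "real (card \<C>) * (12 * exp 1 / real l ^ 4) ^ m \<le> exp (real m) * exp (- 2) ^ m"
    proof (rule mult_mono)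
      have "175000 * (ln (real q))\<^sup>2 \<le> real l * (real l)\<^sup>2"
        using l lnq by (intro mult_mono power_mono) auto
      then have "real q ^ 5 * (175000 * (ln (real q))\<^sup>2) \<le> real q ^ 5 * (real l * (real l)\<^sup>2)"
        by (rule mult_left_mono) simp
      then have "175000 * real q ^ 5 * (ln (real q))\<^sup>2 \<le> real m"
        unfolding m by (simp add: power3_eq_cube power2_eq_square ac_simps)
      then show "real (card \<C>) \<le> exp (real m)" using \<C>(2) by (meson exp_le_cancel_iff order_trans)
      have "12 * exp 1 / real l ^ 4 \<le> exp (- 2 :: real)"
      proof -
        have "exp (3 :: real) = exp 1 ^ 3" by (simp flip: exp_of_nat_mult)
        also have "\<dots> \<le> 3 ^ 3" using exp_le by (intro power_mono) auto
        finally have e3: "exp (3 :: real) \<le> 27" by simp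
        have "(175000 :: real) ^ 4 \<le> real l ^ 4" using l by (intro power_mono) auto
        then have "12 * exp (3 :: real) \<le> real l ^ 4" using e3 by simp
        moreover have "exp (3 :: real) = exp 1 * exp 2" by (simp flip: exp_add)
        ultimately have "12 * exp 1 * exp 2 \<le> real l ^ 4" by simp
        then show ?thesis using l0 by (simp add: exp_minus field_simps)
      qed
      then show "(12 * exp 1 / real l ^ 4) ^ m \<le> exp (- 2) ^ m" by (intro power_mono) auto
    qed auto
    also have "\<dots> = exp (- real m)" by (simp flip: exp_of_nat_mult exp_add)
    finally show ?thesis .
  qed
  have exp_small: "exp (- real m) \<le> 1 / (4 * real k)"
  proof -
    have "4 * k \<le> m"
    proof -
      have "4 \<le> q\<^sup>2 * l\<^sup>2"
      proof -
        have "9 * 1 \<le> q * q" "1 * 1 \<le> l * l" using q l by (intro mult_mono; simp)+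
        then have "9 * 1 \<le> (q * q) * (l * l)" by (intro mult_mono) auto
        then show ?thesis by (simp add: power2_eq_square)
      qed
      then have "4 * (q ^ 3 * l) \<le> (q\<^sup>2 * l\<^sup>2) * (q ^ 3 * l)" by (rule mult_right_mono) simp
      also have "\<dots> = (q\<^sup>2 * q ^ 3) * (l\<^sup>2 * l)" by (simp only: ac_simps)
      also have "\<dots> = m" unfolding m_def by (simp flip: power_add power_Suc2)
      finally show ?thesis unfolding k_def .
    qed
    then have "4 * real k \<le> real m" by linarith
    also have "\<dots> \<le> exp (real m)" using exp_ge_add_one_self[of "real m"] by linarith
    finally have "4 * real k \<le> exp (real m)" .
    then have "1 / exp (real m) \<le> 1 / (4 * real k)" using k1 by (intro divide_left_mono) auto
    then show ?thesis by (simp add: exp_minus inverse_eq_divide)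
  qed
  have "real (card ?V) * (real (card B) / real k ^ m) \<le> real (card ?V) * (1 / (4 * real k))"
    using Bk exp_small by (intro mult_left_mono) auto
  also have "\<dots> = real q ^ 6 / (4 * real l)" using VK by (simp add: field_simps)
  finally have "real q ^ 6 / (2 * real l) \<le> real (card ?V) / real k - real (card Q) / real k ^ 4 - real (card ?V) * (real (card B) / real k ^ m)"
    using Qk unfolding VK by (simp add: field_simps)
  moreover have "0 < real q ^ 6 / (2 * real l)" using q0 l0 by simp
  moreover have "T \<subseteq> ?V \<and> card T = 4" if "T \<in> Q" for T using that unfolding Q_def aligned_subsets_def by auto
  moreover have "T \<subseteq> ?V \<and> card T = m" if "T \<in> B" for T using that \<C>(3) unfolding B_def by blast
  ultimately obtain P where P: "P \<subseteq> ?V" "\<And>T. T \<in> Q \<Longrightarrow> \<not> T \<subseteq> P" "\<And>T. T \<in> B \<Longrightarrow> \<not> T \<subseteq> P"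
    "real q ^ 6 / (2 * real l) \<le> real (card P)"
    using random_sparsification[OF finite_grid k1, of Q "q ^ 3" B m "real q ^ 6 / (2 * real l)"] by metis
  show ?thesis
  proof (rule that[OF P(1) _ P(4)])
    show "aligned_subsets 4 P = {}"
    proof (rule ccontr)
      assume "aligned_subsets 4 P \<noteq> {}"
      then obtain T where "T \<in> aligned_subsets 4 P" by blast
      then have "T \<in> Q" "T \<subseteq> P" using aligned_subsets_mono[OF P(1)] unfolding Q_def aligned_subsets_def by auto
      then show False using P(2) by blast
    qed
    fix S assume S: "S \<subseteq> P" "q ^ 5 * l ^ 3 \<le> card S"
    show "aligned_subsets 3 S \<noteq> {}"
    proof
      assume none: "aligned_subsets 3 S = {}"
      obtain T where T: "T \<subseteq> S" "card T = m" using S(2) unfolding m_def by (meson obtain_subset_with_card_n)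
      have "independent_in (aligned_subsets 3 ?V) T"
        using none T(1) unfolding independent_in_def aligned_subsets_def by blast
      moreover have TP: "T \<subseteq> P" using T S by blast
      ultimately obtain C where "C \<in> \<C>" "T \<subseteq> C" using \<C>(5)[of T] P(1) by blast
      then have "T \<in> B" unfolding B_def using T(2) by blast
      then show False using P(3) TP by blast
    qed
  qed
qed

section \<open>A projection of the grid that preserves collinearity\<close>

lemma dvd_small_eq_0:
  fixes c M :: int
  assumes "M dvd c" "\<bar>c\<bar> < M"
  shows "c = 0"
  using assms dvd_imp_le_int[of c M] by fastforce

text \<open>The first coordinate is a base \<open>M\<close> expansion, so that dual lines get
  distinct slopes. The gap up to \<open>M ^ 3\<close> in the second coordinate keeps the components
  of a cross product apart in the planar determinant.\<close>

fun flatten :: "int \<Rightarrow> point3 \<Rightarrow> real \<times> real" where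
  "flatten M (x, y, z) = (real_of_int (x + M * y + M\<^sup>2 * z), real_of_int (y + M ^ 3 * z))"

lemma inj_fst_flatten:
  assumes "int N \<le> M"
  shows "inj_on (\<lambda>p. fst (flatten M p)) (grid N)"
proof (rule inj_onI)
  fix p q assume pq: "p \<in> grid N" "q \<in> grid N" and eq: "fst (flatten M p) = fst (flatten M q)"
  obtain x y z where p: "p = (x, y, z)" by (cases p)
  obtain x' y' z' where q: "q = (x', y', z')" by (cases q)
  have b: "\<bar>x - x'\<bar> < M" "\<bar>y - y'\<bar> < M" "\<bar>z - z'\<bar> < M" and M: "0 < M"
    using pq assms unfolding p q grid_def by auto
  have "x + M * y + M\<^sup>2 * z = x' + M * y' + M\<^sup>2 * z'" using eq unfolding p q by (simp only: flatten.simps fst_conv of_int_eq_iff)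
  then have e: "x - x' = M * (y' - y + M * (z' - z))" by (simp add: algebra_simps power2_eq_square)
  then have "x - x' = 0" using b(1) by (intro dvd_small_eq_0[of M]) auto
  then have "y - y' = M * (z' - z)" using e M by simp
  moreover from this have "y - y' = 0" using b(2) by (intro dvd_small_eq_0[of M]) auto
  ultimately show "p = q" using \<open>x - x' = 0\<close> M unfolding p q by simp
qed

text \<open>The planar determinant is a combination of the cross product coordinates with powers of
  \<open>M\<close> as coefficients. The coordinates are at most \<open>2 * N\<^sup>2\<close> in
  absolute value, hence below \<open>M\<close>, so divisibility forces \<open>c3\<close>,
  \<open>c1\<close> and \<open>c2\<close> to vanish in turn, like digits.\<close>

lemma collinear_flatten_iff:
  assumes M: "2 * (int N)\<^sup>2 < M" and p: "p \<in> grid N" "q \<in> grid N" "r \<in> grid N"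
  shows "collinear_points (flatten M p) (flatten M q) (flatten M r) \<longleftrightarrow> aligned p q r"
proof -
  obtain x y z where pe: "p = (x, y, z)" by (cases p)
  obtain x' y' z' where qe: "q = (x', y', z')" by (cases q)
  obtain x'' y'' z'' where re: "r = (x'', y'', z'')" by (cases r)
  define d1 d2 d3 e1 e2 e3 where d: "d1 = x' - x" "d2 = y' - y" "d3 = z' - z"
    "e1 = x'' - x" "e2 = y'' - y" "e3 = z'' - z"
  define c1 c2 c3 where c: "c1 = d2 * e3 - d3 * e2" "c2 = d3 * e1 - d1 * e3" "c3 = d1 * e2 - d2 * e1"
  have small: "\<bar>d1\<bar> \<le> int N" "\<bar>d2\<bar> \<le> int N" "\<bar>d3\<bar> \<le> int N" "\<bar>e1\<bar> \<le> int N" "\<bar>e2\<bar> \<le> int N" "\<bar>e3\<bar> \<le> int N"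
    using p unfolding d pe qe re grid_def by auto
  have prod: "\<bar>s * t\<bar> \<le> (int N)\<^sup>2" if "\<bar>s\<bar> \<le> int N" "\<bar>t\<bar> \<le> int N" for s t
    using mult_mono[OF that] by (simp add: abs_mult power2_eq_square)
  have cM: "\<bar>c1\<bar> < M" "\<bar>c2\<bar> < M" "\<bar>c3\<bar> < M"
    unfolding c using M prod[OF small(2,6)] prod[OF small(3,5)] prod[OF small(3,4)] prod[OF small(1,6)]
      prod[OF small(1,5)] prod[OF small(2,4)] by linarith+
  have M0: "0 < M" using M zero_le_power2[of "int N"] by linarith
  have "M * 1 \<le> M * M" using M0 by (intro mult_left_mono) auto
  then have "M \<le> M\<^sup>2" by (simp add: power2_eq_square)
  then have cM2: "\<bar>c3\<bar> < M\<^sup>2" using cM by linarith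
  have "collinear_points (flatten M p) (flatten M q) (flatten M r) \<longleftrightarrow>
      ((y + M ^ 3 * z) - (y' + M ^ 3 * z')) * ((x + M * y + M\<^sup>2 * z) - (x'' + M * y'' + M\<^sup>2 * z'')) =
      ((y + M ^ 3 * z) - (y'' + M ^ 3 * z'')) * ((x + M * y + M\<^sup>2 * z) - (x' + M * y' + M\<^sup>2 * z'))"
    unfolding pe qe re flatten.simps collinear_points.simps
    by (simp only: of_int_diff[symmetric] of_int_mult[symmetric] of_int_eq_iff)
  also have "\<dots> \<longleftrightarrow> (d2 + M ^ 3 * d3) * (e1 + M * e2 + M\<^sup>2 * e3) = (e2 + M ^ 3 * e3) * (d1 + M * d2 + M\<^sup>2 * d3)"
    unfolding d by (simp add: algebra_simps)
  also have "\<dots> \<longleftrightarrow> c3 = M\<^sup>2 * (c1 + M * (c2 - M * c1))"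
    unfolding c by (auto simp: algebra_simps power2_eq_square power3_eq_cube)
  also have "\<dots> \<longleftrightarrow> c1 = 0 \<and> c2 = 0 \<and> c3 = 0"
  proof
    assume e: "c3 = M\<^sup>2 * (c1 + M * (c2 - M * c1))"
    then have c3: "c3 = 0" using cM2 by (intro dvd_small_eq_0[of "M\<^sup>2"]) auto
    then have "c1 + M * (c2 - M * c1) = 0" using e M0 by simp
    then have e1: "c1 = M * (M * c1 - c2)" by (simp add: algebra_simps)
    then have c1: "c1 = 0" using cM(1) by (intro dvd_small_eq_0[of M]) (metis dvd_triv_left, simp)
    then have "c2 = 0" using e1 M0 by simp
    then show "c1 = 0 \<and> c2 = 0 \<and> c3 = 0" using c1 c3 by simp
  qed auto
  also have "\<dots> \<longleftrightarrow> aligned p q r" unfolding pe qe re c d aligned.simps by auto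
  finally show ?thesis .
qed

text \<open>An integral threshold allows the best one for each \<open>n\<close> to be selected with
  \<open>LEAST\<close>; the o(1) terms are read off from it.\<close>

definition unavoidable :: "nat \<Rightarrow> nat \<Rightarrow> bool" where
  "unavoidable n m \<longleftrightarrow> (\<exists>\<L>. simple_arrangement \<L> \<and> card \<L> = n \<and>
     (\<forall>S\<subseteq>\<L>. m \<le> card S \<longrightarrow> (\<exists>C\<in>cells \<L>. cell_lines \<L> C \<subseteq> S)))"

text \<open>Both properties of \<open>P0\<close> pass to subsets, so it can be cut down to exactly
  \<open>n\<close> points.\<close>

lemma unavoidable_grid:
  fixes n q l :: nat
  assumes q: "9 \<le> q" and l: "175000 \<le> l" "ln (real q) \<le> real l" and n: "real n \<le> real q ^ 6 / (2 * real l)"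
  shows "unavoidable n (q ^ 5 * l ^ 3)"
proof -
  define N where "N = q ^ 3"
  obtain P0 where P0: "P0 \<subseteq> grid N" "aligned_subsets 4 P0 = {}" "real q ^ 6 / (2 * real l) \<le> real (card P0)"
    "\<And>S. S \<subseteq> P0 \<Longrightarrow> q ^ 5 * l ^ 3 \<le> card S \<Longrightarrow> aligned_subsets 3 S \<noteq> {}"
    using grid_point_set[OF q l] unfolding N_def by blast
  have "n \<le> card P0" using n P0(3) by linarith
  then obtain P where P: "P \<subseteq> P0" "card P = n" by (meson obtain_subset_with_card_n)
  have PN: "P \<subseteq> grid N" using P P0 by blast
  have finP: "finite P" using PN finite_grid finite_subset by blast
  define M where "M = 2 * (int N)\<^sup>2 + 1"
  have M: "2 * (int N)\<^sup>2 < M" unfolding M_def by simp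
  have NM: "int N \<le> M"
  proof -
    have "int N * 1 \<le> int N * int N" unfolding N_def using q by (intro mult_left_mono) auto
    then show ?thesis unfolding M_def by (simp add: power2_eq_square)
  qed
  define F where "F = flatten M"
  have inj_fst: "inj_on (\<lambda>p. fst (F p)) P"
    unfolding F_def using inj_fst_flatten[OF NM] PN by (rule inj_on_subset)
  then have injF: "inj_on F P" unfolding inj_on_def by metis
  have inj': "inj_on fst (F ` P)" using inj_fst unfolding inj_on_def by blast
  have col: "collinear_points (F p) (F q) (F r) \<longleftrightarrow> aligned p q r" if "p \<in> P" "q \<in> P" "r \<in> P" for p q r
    unfolding F_def by (rule collinear_flatten_iff[OF M]) (use that PN in auto)
  have no4: "\<not> collinear_points p q s"
    if pqrs: "p \<in> F ` P" "q \<in> F ` P" "r \<in> F ` P" "s \<in> F ` P" "distinct [p, q, r, s]" "collinear_points p q r" for p q r s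
  proof
    assume "collinear_points p q s"
    obtain p' q' r' s' where e: "p = F p'" "q = F q'" "r = F r'" "s = F s'" "p' \<in> P" "q' \<in> P" "r' \<in> P" "s' \<in> P"
      using pqrs(1-4) by blast
    have dist: "distinct [p', q', r', s']" using pqrs(5) unfolding e by auto
    have "aligned p' q' r'" "aligned p' q' s'" using pqrs(6) \<open>collinear_points p q s\<close> e col by blast+
    then have "aligned_set {p', q', r', s'}" using dist by (intro aligned_quadruple) auto
    moreover have "card {p', q', r', s'} = 4" using dist by simp
    ultimately have "{p', q', r', s'} \<in> aligned_subsets 4 P0" unfolding aligned_subsets_def using e P(1) by auto
    then show False using P0(2) by blast
  qed
  show ?thesis
  proof (rule arrangement_of_points[OF finite_imageI[OF finP] inj'])
    fix p q r s assume "p \<in> F ` P" "q \<in> F ` P" "r \<in> F ` P" "s \<in> F ` P" "distinct [p, q, r, s]" "collinear_points p q r"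
    then show "\<not> collinear_points p q s" by (rule no4)
  next
    fix L assume L: "inj_on L (F ` P)" "simple_arrangement (L ` F ` P)"
      "\<And>e. \<lbrakk>e \<subseteq> F ` P; card e = 3; \<forall>p\<in>e. \<forall>q\<in>e. \<forall>r\<in>e. collinear_points p q r\<rbrakk>
         \<Longrightarrow> \<exists>C\<in>cells (L ` F ` P). cell_lines (L ` F ` P) C \<subseteq> L ` e"
    show ?thesis unfolding unavoidable_def
    proof (intro exI conjI allI impI)
      show "simple_arrangement (L ` F ` P)" by (rule L(2))
      show "card (L ` F ` P) = n" using L(1) injF P(2) by (simp add: card_image)
      fix S assume S: "S \<subseteq> L ` F ` P" "q ^ 5 * l ^ 3 \<le> card S"
      then obtain S' where S': "S' \<subseteq> P" "S = L ` F ` S'" by (metis subset_imageE image_mono)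
      have "card S \<le> card S'" unfolding S'(2) using finP S'(1)
        by (meson card_image_le finite_imageI finite_subset order_trans)
      then have "aligned_subsets 3 S' \<noteq> {}" using P0(4)[of S'] S S' P(1) by fastforce
      then obtain e where e: "e \<subseteq> S'" "card e = 3" "aligned_set e" unfolding aligned_subsets_def by blast
      have eP: "e \<subseteq> P" using e S' by blast
      have "\<exists>C\<in>cells (L ` F ` P). cell_lines (L ` F ` P) C \<subseteq> L ` F ` e"
      proof (rule L(3))
        show "F ` e \<subseteq> F ` P" using eP by blast
        show "card (F ` e) = 3" using e(2) injF eP by (metis card_image inj_on_subset)
        show "\<forall>p\<in>F ` e. \<forall>q\<in>F ` e. \<forall>r\<in>F ` e. collinear_points p q r"
          using e(3) eP col unfolding aligned_set_def by blast
      qed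
      then show "\<exists>C\<in>cells (L ` F ` P). cell_lines (L ` F ` P) C \<subseteq> S" using e(1) S'(2) by blast
    qed
  qed
qed

section \<open>Asymptotics\<close>

lemma unavoidable_eventually:
  assumes e: "0 < e"
  shows "\<forall>\<^sub>F n in sequentially. \<exists>m. unavoidable n m \<and> real m \<le> real n powr (5 / 6 + e)"
proof -
  \<comment> \<open>The target size of \<open>q\<close>. The logarithm makes \<open>q^6\<close>
    exceed \<open>n\<close> by enough to pay for the factor \<open>2 * l\<close>, which is at most
    \<open>4 * ln n\<close>; the threshold then costs \<open>2^5 * 2^3 = 256\<close> and eight
    logarithms.\<close>
  define y where "y = (\<lambda>n :: nat. real n powr (1 / 6) * ln (real n))"
  have "\<forall>\<^sub>F n in sequentially. exp 175000 \<le> y n" unfolding y_def by real_asymp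
  moreover have "\<forall>\<^sub>F n in sequentially. 2 * y n \<le> real n" unfolding y_def by real_asymp
  moreover have "\<forall>\<^sub>F n in sequentially. 4 \<le> ln (real n)" by real_asymp
  moreover have "\<forall>\<^sub>F n in sequentially. 256 * ln (real n) ^ 8 \<le> real n powr e" using e by real_asymp
  moreover have "\<forall>\<^sub>F n in sequentially. 1 \<le> n" by (rule eventually_ge_at_top)
  ultimately show ?thesis
  proof eventually_elim
    case (elim n)
    note y1 = elim(1) and y2 = elim(2) and ln4 = elim(3) and small = elim(4) and n1 = elim(5)
    define q where "q = nat \<lceil>y n\<rceil>"
    define l where "l = nat \<lceil>ln (real q)\<rceil>"
    have "(175000 :: real) + 1 \<le> exp 175000" using exp_ge_add_one_self[of 175000] by linarith
    then have y9: "9 \<le> y n" using y1 by linarith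
    then have q: "y n \<le> real q" "real q \<le> y n + 1" unfolding q_def by linarith+
    then have q2: "real q \<le> 2 * y n" and q9: "9 \<le> q" using y9 by linarith+
    have q0: "0 < real q" using q9 by simp
    have "exp 175000 \<le> real q" using y1 q by linarith
    then have lnq: "175000 \<le> ln (real q)" using q0 by (simp add: ln_ge_iff)
    then have l: "ln (real q) \<le> real l" "real l \<le> ln (real q) + 1" unfolding l_def by linarith+
    have l5: "175000 \<le> l" using l(1) lnq by linarith
    have "ln (real q) \<le> ln (real n)" using q2 y2 q0 by (subst ln_le_cancel_iff) linarith+
    then have l2: "real l \<le> 2 * ln (real n)" using l(2) ln4 by linarith
    have l0: "0 < real l" using l5 by simp
    have y6: "y n ^ 6 = real n * ln (real n) ^ 6"
      using n1 unfolding y_def power_mult_distrib by (simp flip: powr_realpow add: powr_powr)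
    have y5: "y n ^ 5 = real n powr (5 / 6) * ln (real n) ^ 5"
      using n1 unfolding y_def power_mult_distrib by (simp flip: powr_realpow add: powr_powr)
    have "real n * (2 * real l) \<le> real q ^ 6"
    proof -
      have "real n * (2 * real l) \<le> real n * (4 * ln (real n))" using l2 by (intro mult_left_mono) auto
      also have "\<dots> \<le> real n * (ln (real n) ^ 5 * ln (real n))"
      proof (intro mult_left_mono mult_right_mono)
        have "ln (real n) ^ 1 \<le> ln (real n) ^ 5" using ln4 by (intro power_increasing) auto
        then show "4 \<le> ln (real n) ^ 5" using ln4 by simp
      qed (use ln4 in auto)
      also have "\<dots> = y n ^ 6" unfolding y6 by (simp flip: power_Suc2)
      also have "\<dots> \<le> real q ^ 6" using q(1) y9 by (intro power_mono) auto
      finally show ?thesis .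
    qed
    then have "real n \<le> real q ^ 6 / (2 * real l)" using l0 by (simp add: le_divide_eq)
    then have "unavoidable n (q ^ 5 * l ^ 3)" by (rule unavoidable_grid[OF q9 l5 l(1)])
    moreover have "real (q ^ 5 * l ^ 3) \<le> real n powr (5 / 6 + e)"
    proof -
      have "real (q ^ 5 * l ^ 3) = real q ^ 5 * real l ^ 3" by simp
      also have "\<dots> \<le> (2 * y n) ^ 5 * (2 * ln (real n)) ^ 3"
        using q2 l2 y9 by (intro mult_mono power_mono) auto
      also have "\<dots> = real n powr (5 / 6) * (256 * (ln (real n) ^ 5 * ln (real n) ^ 3))"
        unfolding power_mult_distrib y5 by simp
      also have "\<dots> = real n powr (5 / 6) * (256 * ln (real n) ^ 8)" by (simp flip: power_add)
      also have "\<dots> \<le> real n powr (5 / 6) * real n powr e" using small by (intro mult_left_mono) auto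
      also have "\<dots> = real n powr (5 / 6 + e)" by (rule powr_add[symmetric])
      finally show ?thesis .
    qed
    ultimately show ?case by blast
  qed
qed

text \<open>Makes \<open>LEAST\<close> meaningful for every \<open>n\<close>. The threshold is out
  of reach, so only the existence of a simple arrangement of \<open>n\<close> lines matters, and the
  grid construction with large \<open>q\<close> supplies one.\<close>

lemma unavoidable_Suc: "unavoidable n (Suc n)"
proof -
  have "\<forall>\<^sub>F q in sequentially. real n \<le> real q ^ 6 / (2 * (ln (real q) + 1))" by real_asymp
  moreover have "\<forall>\<^sub>F q in sequentially. exp 175000 \<le> real q" by real_asymp
  moreover have "\<forall>\<^sub>F q :: nat in sequentially. 9 \<le> q" by (rule eventually_ge_at_top)
  ultimately have "\<forall>\<^sub>F q in sequentially. real n \<le> real q ^ 6 / (2 * (ln (real q) + 1)) \<and> exp 175000 \<le> real q \<and> 9 \<le> q"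
    by eventually_elim simp
  then obtain q :: nat where q: "real n \<le> real q ^ 6 / (2 * (ln (real q) + 1))" "exp 175000 \<le> real q" "9 \<le> q"
    using eventually_happens'[OF sequentially_bot] by blast
  define l where "l = nat \<lceil>ln (real q)\<rceil>"
  have lnq: "175000 \<le> ln (real q)" using q by (simp add: ln_ge_iff)
  then have l: "ln (real q) \<le> real l" "real l \<le> ln (real q) + 1" unfolding l_def by linarith+
  have l5: "175000 \<le> l" using l(1) lnq by linarith
  have "real q ^ 6 / (2 * (ln (real q) + 1)) \<le> real q ^ 6 / (2 * real l)"
    using l l5 by (intro divide_left_mono) auto
  then have "unavoidable n (q ^ 5 * l ^ 3)"
    using q by (intro unavoidable_grid[OF q(3) l5 l(1)]) linarith
  then obtain \<L> where \<L>: "simple_arrangement \<L>" "card \<L> = n" unfolding unavoidable_def by blast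
  have "\<not> Suc n \<le> card S" if "S \<subseteq> \<L>" for S
    using card_mono[OF _ that] \<L> unfolding simple_arrangement_def by simp
  then show ?thesis unfolding unavoidable_def using \<L> by blast
qed

text \<open>A colour class larger than \<open>n powr \<alpha>\<close> would contain all lines of
  some cell and make its hyperedge monochromatic, so the classes are small and there must be
  many.\<close>

lemma proper_coloring_lower_bound:
  assumes card: "card \<L> = n" and n: "1 \<le> n"
    and un: "\<And>S. S \<subseteq> \<L> \<Longrightarrow> real n powr \<alpha> \<le> real (card S) \<Longrightarrow> \<exists>C\<in>cells \<L>. cell_lines \<L> C \<subseteq> S"
    and col: "proper_coloring \<L> (line_cell_edges \<L>) k f"
  shows "real n powr (1 - \<alpha>) \<le> real k"
proof -
  have small: "real (card {L \<in> \<L>. f L = c}) \<le> real n powr \<alpha>" for c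
  proof (rule ccontr)
    assume "\<not> ?thesis"
    then obtain C where C: "C \<in> cells \<L>" "cell_lines \<L> C \<subseteq> {L \<in> \<L>. f L = c}"
      using un[of "{L \<in> \<L>. f L = c}"] by auto
    then have "cell_lines \<L> C \<in> line_cell_edges \<L>" unfolding line_cell_edges_def by blast
    then have "\<not> (\<exists>c. \<forall>v\<in>cell_lines \<L> C. f v = c)" using col unfolding proper_coloring_def by metis
    moreover have "\<forall>v\<in>cell_lines \<L> C. f v = c" using C(2) by auto
    ultimately show False by blast
  qed
  have "\<L> = (\<Union>c\<in>{..<k}. {L \<in> \<L>. f L = c})" using col unfolding proper_coloring_def by auto
  then have "card \<L> \<le> (\<Sum>c<k. card {L \<in> \<L>. f L = c})"
    using card_UN_le[of "{..<k}" "\<lambda>c. {L \<in> \<L>. f L = c}"] by simp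
  then have "real n \<le> (\<Sum>c<k. real (card {L \<in> \<L>. f L = c}))"
    unfolding card of_nat_sum[symmetric] by (simp only: of_nat_le_iff)
  also have "\<dots> \<le> (\<Sum>c<k. real n powr \<alpha>)" by (rule sum_mono[OF small])
  also have "\<dots> = real k * real n powr \<alpha>" by simp
  finally have "real n / real n powr \<alpha> \<le> real k" using n by (simp add: divide_le_eq)
  moreover have "real n powr (1 - \<alpha>) = real n / real n powr \<alpha>" using n by (simp add: powr_diff)
  ultimately show ?thesis by simp
qed

theorem theorem2p7:
  "\<exists>\<epsilon> \<delta> :: nat \<Rightarrow> real. (\<epsilon> \<longlongrightarrow> 0) sequentially \<and> (\<delta> \<longlongrightarrow> 0) sequentially \<and>
     (\<forall>n. \<exists>\<L>. simple_arrangement \<L> \<and> card \<L> = n \<and>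
        (\<forall>S\<subseteq>\<L>. real (card S) \<ge> real n powr (5/6 + \<epsilon> n) \<longrightarrow>
            (\<exists>C\<in>cells \<L>. cell_lines \<L> C \<subseteq> S)) \<and>
        (\<forall>k f. proper_coloring \<L> (line_cell_edges \<L>) k f \<longrightarrow>
            real k \<ge> real n powr (1/6 - \<delta> n)))"
proof -
  define \<mu> where "\<mu> n = (LEAST m. unavoidable n m)" for n
  have \<mu>: "unavoidable n (\<mu> n)" for n unfolding \<mu>_def by (rule LeastI) (rule unavoidable_Suc)
  \<comment> \<open>For \<open>n >= 2\<close> this makes
    \<open>n powr (5 / 6 + \<epsilon> n)\<close> at least \<open>\<mu> n\<close>. Because of the
    maximum with 0, the limit requires only an upper bound on \<open>\<mu> n\<close>. The same
    function serves as \<open>\<delta>\<close>.\<close>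
  define \<epsilon> where "\<epsilon> n = max 0 (ln (real (\<mu> n)) / ln (real n) - 5 / 6)" for n
  have lim: "(\<epsilon> \<longlongrightarrow> 0) sequentially"
  proof (rule tendstoI)
    fix e :: real assume e: "0 < e"
    have "\<forall>\<^sub>F n in sequentially. \<exists>m. unavoidable n m \<and> real m \<le> real n powr (5 / 6 + e / 2)"
      using e by (intro unavoidable_eventually) simp
    moreover have "\<forall>\<^sub>F n :: nat in sequentially. 2 \<le> n" by (rule eventually_ge_at_top)
    ultimately show "\<forall>\<^sub>F n in sequentially. dist (\<epsilon> n) 0 < e"
    proof eventually_elim
      case (elim n)
      then obtain m where m: "unavoidable n m" "real m \<le> real n powr (5 / 6 + e / 2)" by blast
      have "\<mu> n \<le> m" unfolding \<mu>_def using m(1) by (rule Least_le)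
      then have \<mu>_le: "real (\<mu> n) \<le> real n powr (5 / 6 + e / 2)" using m(2) by linarith
      have lnn: "0 < ln (real n)" using elim(2) by simp
      have "ln (real (\<mu> n)) \<le> (5 / 6 + e / 2) * ln (real n)"
      proof (cases "\<mu> n = 0")
        case True
        then show ?thesis using lnn e by simp
      next
        case False
        then have "ln (real (\<mu> n)) \<le> ln (real n powr (5 / 6 + e / 2))"
          using \<mu>_le elim(2) by (subst ln_le_cancel_iff) auto
        then show ?thesis using elim(2) by (simp add: ln_powr)
      qed
      then have "ln (real (\<mu> n)) / ln (real n) \<le> 5 / 6 + e / 2" using lnn by (simp add: divide_le_eq)
      then show ?case unfolding \<epsilon>_def dist_real_def using e by linarith
    qed
  qed
  have arrangement: "\<exists>\<L>. simple_arrangement \<L> \<and> card \<L> = n \<and>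
        (\<forall>S\<subseteq>\<L>. real (card S) \<ge> real n powr (5/6 + \<epsilon> n) \<longrightarrow> (\<exists>C\<in>cells \<L>. cell_lines \<L> C \<subseteq> S))" for n
  proof -
    consider "n = 0" | "n = 1" | "2 \<le> n" by linarith
    then show ?thesis
    proof cases
      \<comment> \<open>Here \<open>0 powr x = 0\<close>, so even the empty set must contain all
        lines of a cell; the whole plane is a cell bounded by no line.\<close>
      case 1
      have "cells {} = {UNIV}" unfolding cells_def by simp
      then show ?thesis using 1 by (intro exI[of _ "{}"]) (simp add: simple_arrangement_def cell_lines_def)
    next
      \<comment> \<open>Here \<open>1 powr x = 1\<close> for every exponent, so
        \<open>\<epsilon>\<close> cannot raise the threshold; the only set to treat is the whole
        arrangement.\<close>
      case 2
      let ?L = "graph_line 0 0"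
      have "vector [0, 1] \<in> - ?L" unfolding graph_line_def by simp
      then have "cells {?L} \<noteq> {}" unfolding cells_def by (auto simp: components_eq_empty)
      then obtain C where C: "C \<in> cells {?L}" by blast
      have "\<exists>C\<in>cells {?L}. cell_lines {?L} C \<subseteq> S" if "S \<subseteq> {?L}" "1 \<le> real (card S)" for S
      proof -
        have "S = {?L}" using that by (auto simp: subset_singleton_iff)
        then show ?thesis using C unfolding cell_lines_def by blast
      qed
      then show ?thesis using 2 is_line_graph_line
        by (intro exI[of _ "{?L}"]) (simp add: simple_arrangement_def)
    next
      case 3
      obtain \<L> where \<L>: "simple_arrangement \<L>" "card \<L> = n"
        "\<forall>S\<subseteq>\<L>. \<mu> n \<le> card S \<longrightarrow> (\<exists>C\<in>cells \<L>. cell_lines \<L> C \<subseteq> S)"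
        using \<mu>[of n] unfolding unavoidable_def by blast
      have "real (\<mu> n) \<le> real n powr (5 / 6 + \<epsilon> n)"
      proof (cases "\<mu> n = 0")
        case False
        have "real (\<mu> n) = real n powr (ln (real (\<mu> n)) / ln (real n))"
          using False 3 by (simp add: powr_def)
        also have "\<dots> \<le> real n powr (5 / 6 + \<epsilon> n)"
          using 3 unfolding \<epsilon>_def by (intro powr_mono) auto
        finally show ?thesis .
      qed simp
      then have "\<mu> n \<le> card S" if "real n powr (5 / 6 + \<epsilon> n) \<le> real (card S)" for S :: "(real^2) set set"
        using that by linarith
      then show ?thesis using \<L> by (intro exI[of _ \<L>]) auto
    qed
  qed
  have "\<exists>\<L>. simple_arrangement \<L> \<and> card \<L> = n \<and>
        (\<forall>S\<subseteq>\<L>. real (card S) \<ge> real n powr (5/6 + \<epsilon> n) \<longrightarrow> (\<exists>C\<in>cells \<L>. cell_lines \<L> C \<subseteq> S)) \<and>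
        (\<forall>k f. proper_coloring \<L> (line_cell_edges \<L>) k f \<longrightarrow> real k \<ge> real n powr (1/6 - \<epsilon> n))" for n
  proof -
    obtain \<L> where \<L>: "simple_arrangement \<L>" "card \<L> = n"
      "\<forall>S\<subseteq>\<L>. real (card S) \<ge> real n powr (5/6 + \<epsilon> n) \<longrightarrow> (\<exists>C\<in>cells \<L>. cell_lines \<L> C \<subseteq> S)"
      using arrangement[of n] by blast
    have "real n powr (1/6 - \<epsilon> n) \<le> real k" if "proper_coloring \<L> (line_cell_edges \<L>) k f" for k f
    proof (cases "n = 0")
      case False
      have "real n powr (1 - (5/6 + \<epsilon> n)) \<le> real k"
        using proper_coloring_lower_bound[of \<L> n "5/6 + \<epsilon> n" k f] \<L>(2,3) that False by auto
      then show ?thesis by (simp add: algebra_simps)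
    qed simp
    then show ?thesis using \<L> by blast
  qed
  then show ?thesis using lim by blast
qed

end
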